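(* For every integer $n\ge 1$, the approximation factor of Double Proposal over the family $\mathcal I_{\rm Gen}$ of all instances of HRT-MSLQ with $n$ residents is $$\max_{I}\frac{\mathrm{OPT}(I)}{\mathrm{ALG}(I)}=\phi(n),$$ where the maximum is over all instances $I$ of HRT-MSLQ with $|R|=n$, and $\phi(1)=1$, $\phi(2)=\frac32$, and $\phi(n)=\dfrac{n(1+\lfloor n/2\rfloor)}{n+\lfloor n/2\rfloor}$ for $n\ge 3$.
   Context: Problem. An instance $I$ of HRT-MSLQ consists of a set $R=\{r_1,\dots,r_n\}$ of residents ($n\ge 1$) and a set $H=\{h_1,\dots,h_m\}$ of hospitals (agents are indexed). Each resident $r$ has a complete preference list over $H$ that may contain ties (a total preorder $\succeq_r$; $\succ_r$ is strict preference, $=_r$ indifference), and each hospital $h$ likewise has a complete preference list over $R$ that may contain ties. Each hospital $h$ has an integer lower quota $\ell(h)$ and upper quota $u(h)$ with $0\le \ell(h)\le u(h)\le n$, $u(h)\ge 1$. Standing assumption: $|R|<\sum_{h\in H}u(h)$. An assignment is a set $M\subseteq R\times H$; $M(r)=\{h:(r,h)\in M\}$, $M(h)=\{r:(r,h)\in M\}$. $M$ is a matching if $|M(r)|\le 1$ for all $r$ and $|M(h)|\le u(h)$ for all $h$; then $M(r)$ also denotes the unique hospital of a matched resident $r$. A pair $(r,h)$ blocks a matching $M$ if (i) $r$ is unmatched in $M$ or $h\succ_r M(r)$, and (ii) $|M(h)|<u(h)$ or $h$ strictly prefers $r$ to at least one resident in $M(h)$. $M$ is stable if no pair blocks it. The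 score of $h$ in $M$ is $s_M(h)=\min\{1,|M(h)|/\ell(h)\}$, with $s_M(h)=1$ if $\ell(h)=0$; the score of $M$ is $s(M)=\sum_{h\in H}s_M(h)$. $\mathrm{OPT}(I)$ is the maximum of $s(M)$ over stable matchings $M$ of $I$. $\mathrm{ALG}(I)$ is the score of the output of Double Proposal on $I$. Algorithm Double Proposal (deterministic). Regard a hospital not in any tie of a resident's list as a tie of length one. Start with $M:=\emptyset$. While some resident is unmatched in $M$: let $r$ be the unmatched resident with smallest index and $T$ the top tie of $r$'s current list. If $T$ contains a hospital to which $r$ has not yet proposed, let $h$ be such a hospital with minimum $\ell(h)$; otherwise let $h$ be a hospital in $T$ with minimum $\ell(h)$ (in both cases break remaining ties by smallest hospital index). Resident $r$ proposes to $h$, and then: (1) if $|M(h)|<\ell(h)$, set $M:=M\cup\{(r,h)\}$; (2) else, if some resident in $M(h)\cup\{r\}$ has not been rejected by $h$ so far, let $r'$ be the one among such residents with the largest index (possibly $r'=r$) and set $M:=(M\cup\{(r,h)\})\setminus\{(r',h)\}$; (3) else, if $|M(h)|<u(h)$, set $M:=M\cup\{(r,h)\}$; (4) else, let $r'$ be a resident in $M(h)\cup\{r\}$ that is worst for $h$ (the one with largest index if there are several; possibly $r'=r$), set $M:=(M\cup\{(r,h)\})\setminus\{(r',h)\}$, and delete $h$ from the list of $r'$. In (2) and (4), $r'$ is said to be rejected by $h$. When no resident is unmatched, output $M$. (The output is a stable matching.) *)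

theory Defs
  imports Complex_Main "HOL-Library.While_Combinator"
begin

text \<open>
  Residents are the indices \<open>1, \<dots>, num_residents I\<close> and hospitals are
  \<open>1, \<dots>, num_hospitals I\<close>. A pair \<open>(x, y)\<close> in a preference relation means that
  \<open>x\<close> is weakly preferred to \<open>y\<close>; two mutually related agents are tied.
\<close>

record hrt_instance =
  num_residents :: nat
  num_hospitals :: nat
  rpref :: "nat \<Rightarrow> nat rel"
  hpref :: "nat \<Rightarrow> nat rel"
  lower :: "nat \<Rightarrow> nat"
  upper :: "nat \<Rightarrow> nat"

definition residents :: "hrt_instance \<Rightarrow> nat set" where
  "residents I = {1..num_residents I}"

definition hospitals :: "hrt_instance \<Rightarrow> nat set" where
  "hospitals I = {1..num_hospitals I}"

definition total_preorder_on :: "'a set \<Rightarrow> 'a rel \<Rightarrow> bool" where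
  "total_preorder_on A p \<longleftrightarrow> preorder_on A p \<and> total_on A p"

definition hrt_mslq :: "hrt_instance \<Rightarrow> bool" where
  "hrt_mslq I \<longleftrightarrow>
     num_residents I \<ge> 1 \<and>
     (\<forall>r\<in>residents I. total_preorder_on (hospitals I) (rpref I r)) \<and>
     (\<forall>h\<in>hospitals I. total_preorder_on (residents I) (hpref I h)) \<and>
     (\<forall>h\<in>hospitals I. lower I h \<le> upper I h \<and> upper I h \<le> num_residents I \<and> upper I h \<ge> 1) \<and>
     num_residents I < (\<Sum>h\<in>hospitals I. upper I h)"

definition strictly :: "'a rel \<Rightarrow> 'a \<Rightarrow> 'a \<Rightarrow> bool" where
  "strictly p x y \<longleftrightarrow> (x, y) \<in> p \<and> (y, x) \<notin> p"

type_synonym assignment = "(nat \<times> nat) set"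

definition hosps_of :: "assignment \<Rightarrow> nat \<Rightarrow> nat set" where
  "hosps_of M r = {h. (r, h) \<in> M}"

definition ress_of :: "assignment \<Rightarrow> nat \<Rightarrow> nat set" where
  "ress_of M h = {r. (r, h) \<in> M}"

definition matching :: "hrt_instance \<Rightarrow> assignment \<Rightarrow> bool" where
  "matching I M \<longleftrightarrow>
     M \<subseteq> residents I \<times> hospitals I \<and>
     (\<forall>r\<in>residents I. card (hosps_of M r) \<le> 1) \<and>
     (\<forall>h\<in>hospitals I. card (ress_of M h) \<le> upper I h)"

definition blocks :: "hrt_instance \<Rightarrow> assignment \<Rightarrow> nat \<Rightarrow> nat \<Rightarrow> bool" where
  "blocks I M r h \<longleftrightarrow>
     (hosps_of M r = {} \<or> (\<exists>h'\<in>hosps_of M r. strictly (rpref I r) h h')) \<and>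
     (card (ress_of M h) < upper I h \<or> (\<exists>r'\<in>ress_of M h. strictly (hpref I h) r r'))"

definition stable_matching :: "hrt_instance \<Rightarrow> assignment \<Rightarrow> bool" where
  "stable_matching I M \<longleftrightarrow>
     matching I M \<and> \<not> (\<exists>r\<in>residents I. \<exists>h\<in>hospitals I. blocks I M r h)"

definition hosp_score :: "hrt_instance \<Rightarrow> assignment \<Rightarrow> nat \<Rightarrow> real" where
  "hosp_score I M h =
     (if lower I h = 0 then 1 else min 1 (real (card (ress_of M h)) / real (lower I h)))"

definition score :: "hrt_instance \<Rightarrow> assignment \<Rightarrow> real" where
  "score I M = (\<Sum>h\<in>hospitals I. hosp_score I M h)"

definition OPT :: "hrt_instance \<Rightarrow> real" where
  "OPT I = Max {score I M | M. stable_matching I M}"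

text \<open>
  Besides the current assignment, a state records the pairs \<open>(r, h)\<close> such that so far
  \<open>r\<close> has proposed to \<open>h\<close>, \<open>h\<close> has rejected \<open>r\<close>, and \<open>h\<close> has been deleted from the
  list of \<open>r\<close>, respectively.
\<close>

record dp_state =
  asg :: assignment
  proposed :: "(nat \<times> nat) set"
  rejected :: "(nat \<times> nat) set"
  deleted :: "(nat \<times> nat) set"

definition dp_init :: dp_state where
  "dp_init = \<lparr>asg = {}, proposed = {}, rejected = {}, deleted = {}\<rparr>"

definition unmatched :: "hrt_instance \<Rightarrow> dp_state \<Rightarrow> nat set" where
  "unmatched I s = {r \<in> residents I. hosps_of (asg s) r = {}}"

definition current_list :: "hrt_instance \<Rightarrow> dp_state \<Rightarrow> nat \<Rightarrow> nat set" where
  "current_list I s r = {h \<in> hospitals I. (r, h) \<notin> deleted s}"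

definition top_tie :: "hrt_instance \<Rightarrow> dp_state \<Rightarrow> nat \<Rightarrow> nat set" where
  "top_tie I s r = {h \<in> current_list I s r. \<forall>h'\<in>current_list I s r. (h, h') \<in> rpref I r}"

definition min_lower :: "hrt_instance \<Rightarrow> nat set \<Rightarrow> nat" where
  "min_lower I A = Min {h \<in> A. \<forall>h'\<in>A. lower I h \<le> lower I h'}"

definition target :: "hrt_instance \<Rightarrow> dp_state \<Rightarrow> nat \<Rightarrow> nat" where
  "target I s r =
     (let T = top_tie I s r; N = {h \<in> T. (r, h) \<notin> proposed s}
      in if N \<noteq> {} then min_lower I N else min_lower I T)"

definition worst_resident :: "hrt_instance \<Rightarrow> nat \<Rightarrow> nat set \<Rightarrow> nat" where
  "worst_resident I h A = Max {r \<in> A. \<forall>r'\<in>A. (r', r) \<in> hpref I h}"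

definition propose :: "hrt_instance \<Rightarrow> nat \<Rightarrow> nat \<Rightarrow> dp_state \<Rightarrow> dp_state" where
  "propose I r h s =
     (let M = asg s;
          s1 = s\<lparr>proposed := insert (r, h) (proposed s)\<rparr>;
          A = insert r (ress_of M h);
          F = {r' \<in> A. (r', h) \<notin> rejected s}
      in if card (ress_of M h) < lower I h then s1\<lparr>asg := insert (r, h) M\<rparr>
         else if F \<noteq> {} then
           (let r' = Max F
            in s1\<lparr>asg := insert (r, h) M - {(r', h)}, rejected := insert (r', h) (rejected s)\<rparr>)
         else if card (ress_of M h) < upper I h then s1\<lparr>asg := insert (r, h) M\<rparr>
         else
           (let r' = worst_resident I h A
            in s1\<lparr>asg := insert (r, h) M - {(r', h)}, rejected := insert (r', h) (rejected s),
                  deleted := insert (r', h) (deleted s)\<rparr>))"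

definition dp_step :: "hrt_instance \<Rightarrow> dp_state \<Rightarrow> dp_state" where
  "dp_step I s = (let r = Min (unmatched I s) in propose I r (target I s r) s)"

definition double_proposal :: "hrt_instance \<Rightarrow> assignment" where
  "double_proposal I = asg (while (\<lambda>s. unmatched I s \<noteq> {}) (dp_step I) dp_init)"

definition ALG :: "hrt_instance \<Rightarrow> real" where
  "ALG I = score I (double_proposal I)"

definition is_maximum :: "'a::order set \<Rightarrow> 'a \<Rightarrow> bool" where
  "is_maximum S x \<longleftrightarrow> x \<in> S \<and> (\<forall>y\<in>S. y \<le> x)"

definition phi :: "nat \<Rightarrow> real" where
  "phi n =
     (if n = 1 then 1 else if n = 2 then 3 / 2
      else real n * (1 + real (n div 2)) / (real n + real (n div 2)))"

end

theory Submission
  imports Defs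
begin

text \<open>
  Let \<open>M\<close> be the output of the algorithm and \<open>N\<close> a stable matching. If \<open>h\<close> has a higher score
  in \<open>N\<close> than in \<open>M\<close>, it is not full in \<open>M\<close>, so a resident \<open>r\<close> entering \<open>h\<close> comes from a hospital
  \<open>g\<close> that \<open>r\<close> weakly prefers to \<open>h\<close>. If \<open>r\<close> is indifferent, the order of proposals forces
  \<open>\<ell>(g) \<le> \<ell>(h)\<close> and \<open>|M(g)| \<le> \<ell>(g)\<close>, so the contribution of \<open>r\<close> to the score of \<open>M\<close> pays for
  the gain. If \<open>r\<close> strictly prefers \<open>g\<close>, stability of \<open>N\<close> makes \<open>g\<close> full in \<open>N\<close>, so \<open>r\<close> is
  replaced there by another resident. Such replacements propagate to residents leaving
  hospitals that shrink, each of whom costs \<open>N\<close> at least \<open>1/n\<close> or leaves a hospital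
  which stays fully satisfied; as every gain not paid for involves two residents, there are
  \<open>x \<le> n/2\<close> of them, and the ratio is at most \<open>(1 + x) / (1 + x/n)\<close> or \<open>(2 + x) / 2\<close>.

  For tightness, all hospitals are indifferent between residents, so the algorithm fills the
  common favourite with the residents of smallest index, while those of largest index could
  occupy it and free the others to satisfy hospitals of lower quota one.
\<close>

section \<open>Scores of two assignments of the same residents\<close>

definition quota_score :: "nat \<Rightarrow> nat \<Rightarrow> real" where
  "quota_score l c = (if l = 0 then 1 else min 1 (real c / real l))"

lemma quota_score_nonneg: "0 \<le> quota_score l c"
  by (simp add: quota_score_def)

text \<open>
  In the application \<open>a\<close> is the output of the algorithm and \<open>b\<close> a stable matching; the two cases of
  \<open>gain_source\<close> are indifference and strict preference of a resident moving to a gaining hospital.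
\<close>
locale reassignment =
  fixes R :: "'r set" and H :: "'h set" and a b :: "'r \<Rightarrow> 'h" and l :: "'h \<Rightarrow> nat"
    and ca cb :: "'h \<Rightarrow> nat"
  defines "ca h \<equiv> card {r \<in> R. a r = h}" and "cb h \<equiv> card {r \<in> R. b r = h}"
  assumes finite_R: "finite R" and finite_H: "finite H" and R_nonempty: "R \<noteq> {}"
    and a_in: "r \<in> R \<Longrightarrow> a r \<in> H" and b_in: "r \<in> R \<Longrightarrow> b r \<in> H"
    and quota_le: "h \<in> H \<Longrightarrow> l h \<le> card R"
    and gain_source: "\<lbrakk>r \<in> R; a r \<noteq> b r; ca (b r) < l (b r); ca (b r) < cb (b r)\<rbrakk> \<Longrightarrow>
      l (a r) \<le> l (b r) \<and> ca (a r) \<le> l (a r) \<or> l (a r) \<le> cb (a r) \<and> ca (a r) \<le> cb (a r)"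
begin

section \<open>Gaining hospitals and the residents who pay for them\<close>

definition gains :: "'h \<Rightarrow> bool" where
  "gains h \<longleftrightarrow> ca h < l h \<and> ca h < cb h"

text \<open>The hospitals whose score under \<open>a\<close> is the sum of equal contributions of their residents.\<close>
definition additive :: "'h \<Rightarrow> bool" where
  "additive h \<longleftrightarrow> 0 < l h \<and> ca h \<le> l h"

abbreviation weight :: "'r \<Rightarrow> real" where
  "weight r \<equiv> 1 / real (l (a r))"

abbreviation total :: "('h \<Rightarrow> nat) \<Rightarrow> real" where
  "total c \<equiv> \<Sum>h\<in>H. quota_score (l h) (c h)"

text \<open>Sources for which the second alternative of \<open>gain_source\<close> is available:
  under \<open>b\<close> they reach their quota, hence have score 1, and they do not shrink.\<close>

definition refilled_sources :: "'h set" where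
  "refilled_sources = {a r | r. r \<in> R \<and> a r \<noteq> b r \<and> gains (b r) \<and> l (a r) \<le> cb (a r) \<and> ca (a r) \<le> cb (a r)}"

lemma ca_pos: "r \<in> R \<Longrightarrow> 0 < ca (a r)"
  using finite_R by (auto simp: ca_def card_gt_0_iff)

text \<open>Outside the refilled sources only the first alternative of \<open>gain_source\<close>
  remains. As \<open>r\<close> itself makes \<open>ca (a r)\<close> positive, so is
  \<open>l (a r)\<close>, and the share of \<open>r\<close> in the score of its source covers the
  share it adds at \<open>b r\<close>.\<close>

lemma gain_cases:
  assumes "r \<in> R" "a r \<noteq> b r" "gains (b r)" "a r \<notin> refilled_sources"
  shows "additive (a r)" "l (a r) \<le> l (b r)" "1 / real (l (b r)) \<le> weight r"
proof -
  from assms gain_source[of r] have *: "l (a r) \<le> l (b r) \<and> ca (a r) \<le> l (a r)"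
    unfolding refilled_sources_def gains_def by blast
  then show "additive (a r)" "l (a r) \<le> l (b r)"
    using ca_pos[OF assms(1)] by (auto simp: additive_def)
  then show "1 / real (l (b r)) \<le> weight r"
    by (auto simp: additive_def frac_le)
qed

text \<open>Hospitals in \<open>G\<close> have score 1 and count fully; the others count through the
  shares of their residents in \<open>X\<close>. Keeping the sources of \<open>X\<close> out of
  \<open>G\<close> avoids double counting.\<close>

lemma total_lower:
  assumes "G \<subseteq> H" "\<And>g. g \<in> G \<Longrightarrow> l g \<le> ca g"
    and X: "X \<subseteq> R" "\<And>r. r \<in> X \<Longrightarrow> additive (a r)" "\<And>r. r \<in> X \<Longrightarrow> a r \<notin> G"
  shows "real (card G) + (\<Sum>r\<in>X. weight r) \<le> total ca"
proof -
  have fX: "finite X" using X finite_R finite_subset by blast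
  have fG: "finite G" using assms finite_H finite_subset by blast
  have "(\<Sum>r\<in>X. weight r) = (\<Sum>h\<in>H - G. \<Sum>r\<in>{r\<in>X. a r = h}. weight r)"
    using X a_in fX finite_H by (subst sum.group) auto
  also have "\<dots> \<le> (\<Sum>h\<in>H - G. quota_score (l h) (ca h))"
  proof (rule sum_mono)
    fix h assume "h \<in> H - G"
    show "(\<Sum>r\<in>{r\<in>X. a r = h}. weight r) \<le> quota_score (l h) (ca h)"
    proof (cases "{r\<in>X. a r = h} = {}")
      case True
      then show ?thesis by (simp only: True quota_score_nonneg sum.empty)
    next
      case False
      then have "additive h" using X by auto
      have "(\<Sum>r\<in>{r\<in>X. a r = h}. weight r) = (\<Sum>r\<in>{r\<in>X. a r = h}. 1 / real (l h))"
        by (rule sum.cong) auto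
      also have "\<dots> = real (card {r\<in>X. a r = h}) / real (l h)" by simp
      also have "\<dots> \<le> real (ca h) / real (l h)"
        unfolding ca_def using X finite_R by (intro divide_right_mono of_nat_mono card_mono) auto
      also have "\<dots> = quota_score (l h) (ca h)"
        using \<open>additive h\<close> by (auto simp: additive_def quota_score_def min_def)
      finally show ?thesis .
    qed
  qed
  finally have 1: "(\<Sum>r\<in>X. weight r) \<le> (\<Sum>h\<in>H - G. quota_score (l h) (ca h))" .
  have "(\<Sum>h\<in>G. quota_score (l h) (ca h)) = (\<Sum>h\<in>G. 1)"
    using assms(2) by (intro sum.cong) (auto simp: quota_score_def min_def field_simps)
  then show ?thesis
    using 1 sum.subset_diff[OF assms(1) finite_H, of "\<lambda>h. quota_score (l h) (ca h)"] by simp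
qed

text \<open>Truncation at 1 only lowers the score under \<open>b\<close> of a gaining hospital,
  while additive hospitals are not truncated under \<open>a\<close>. In the remaining cases the
  score under \<open>a\<close> is already 1 and the right side vanishes.\<close>

lemma quota_score_diff:
  "quota_score (l h) (cb h) - quota_score (l h) (ca h)
   \<le> (if gains h then real (cb h - ca h) / real (l h) else 0)
     - (if additive h then real (ca h - cb h) / real (l h) else 0)"
proof (cases "l h = 0")
  case True
  then show ?thesis by (simp add: quota_score_def gains_def additive_def)
next
  case False
  then have l: "real (l h) > 0" by simp
  consider "ca h < cb h" "ca h < l h" | "ca h < cb h" "l h \<le> ca h"
    | "cb h \<le> ca h" "ca h \<le> l h" | "cb h \<le> ca h" "l h < ca h" by linarith
  then show ?thesis
  proof cases
    case 1
    have "quota_score (l h) (cb h) \<le> real (cb h) / real (l h)"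
      using False by (simp add: quota_score_def)
    moreover have "quota_score (l h) (ca h) = real (ca h) / real (l h)"
      using False 1 by (simp add: quota_score_def min_def)
    ultimately show ?thesis using 1
      by (simp add: gains_def of_nat_diff diff_divide_distrib)
  next
    case 2
    then show ?thesis using False by (auto simp: quota_score_def gains_def min_def field_simps)
  next
    case 3
    then have "quota_score (l h) (ca h) = real (ca h) / real (l h)"
      "quota_score (l h) (cb h) = real (cb h) / real (l h)"
      using False l by (auto simp: quota_score_def min_def divide_le_eq)
    then show ?thesis using 3 False
      by (simp add: gains_def additive_def of_nat_diff diff_divide_distrib)
  next
    case 4
    then show ?thesis using False by (auto simp: quota_score_def gains_def additive_def min_def field_simps)
  qed
qed

section \<open>Residents realizing the net changes\<close>

lemma in_out_balance:
  "card {r \<in> R. b r = h \<and> a r \<noteq> h} + ca h = card {r \<in> R. a r = h \<and> b r \<noteq> h} + cb h"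
proof -
  have "ca h = card {r \<in> R. a r = h \<and> b r = h} + card {r \<in> R. a r = h \<and> b r \<noteq> h}"
    unfolding ca_def using finite_R by (subst card_Un_disjoint[symmetric]) (auto intro: arg_cong[where f=card])
  moreover have "cb h = card {r \<in> R. a r = h \<and> b r = h} + card {r \<in> R. b r = h \<and> a r \<noteq> h}"
    unfolding cb_def using finite_R by (subst card_Un_disjoint[symmetric]) (auto intro: arg_cong[where f=card])
  ultimately show ?thesis by simp
qed

text \<open>By \<open>in_out_balance\<close> a growing hospital has enough entrants to choose from,
  and choices for different hospitals are disjoint. Truncated subtraction lets hospitals that do not
  grow contribute nobody.\<close>

lemma surplus_entrants:
  "\<exists>E \<subseteq> {r \<in> R. a r \<noteq> b r}. \<forall>h. card {r \<in> E. b r = h} = cb h - ca h"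
proof -
  have "\<exists>A \<subseteq> {r \<in> R. b r = h \<and> a r \<noteq> h}. card A = cb h - ca h" for h
    using in_out_balance[of h] obtain_subset_with_card_n[of "cb h - ca h" "{r \<in> R. b r = h \<and> a r \<noteq> h}"]
    by (metis (no_types, lifting) add.commute le_add2 le_diff_conv)
  then obtain e where e: "\<And>h. e h \<subseteq> {r \<in> R. b r = h \<and> a r \<noteq> h}" "\<And>h. card (e h) = cb h - ca h"
    by metis
  moreover have "{r \<in> (\<Union>h. e h). b r = h} = e h" for h
    using e(1) by blast
  ultimately show ?thesis
    by (intro exI[of _ "\<Union>h. e h"]) fastforce
qed

lemma surplus_leavers:
  "\<exists>S \<subseteq> {r \<in> R. a r \<noteq> b r}. \<forall>h. card {r \<in> S. a r = h} = ca h - cb h"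
proof -
  have "\<exists>A \<subseteq> {r \<in> R. a r = h \<and> b r \<noteq> h}. card A = ca h - cb h" for h
    using in_out_balance[of h] obtain_subset_with_card_n[of "ca h - cb h" "{r \<in> R. a r = h \<and> b r \<noteq> h}"]
    by (metis (no_types, lifting) add.commute le_add2 le_diff_conv)
  then obtain s where s: "\<And>h. s h \<subseteq> {r \<in> R. a r = h \<and> b r \<noteq> h}" "\<And>h. card (s h) = ca h - cb h"
    by metis
  moreover have "{r \<in> (\<Union>h. s h). a r = h} = s h" for h
    using s(1) by blast
  ultimately show ?thesis
    by (intro exI[of _ "\<Union>h. s h"]) fastforce
qed

text \<open>
  If some refilled source has score 1 under \<open>a\<close>, it can be added to the contributions of \<open>S\<close>. If not,
  all refilled sources gain, and every resident entering one of them from elsewhere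
  contributes at least as much to \<open>a\<close> as its gain: with \<open>f\<close> the refilled source of largest quota,
  the set \<open>W\<close> of residents in or entering refilled sources has at least
  \<open>l f + card (W \<inter> S)\<close> members, each contributing at least \<open>1 / l f\<close>.
\<close>
lemma refilled_sources_bound:
  assumes S: "S \<subseteq> R" "\<And>r. r \<in> S \<Longrightarrow> cb (a r) < ca (a r)"
    and through: "\<And>h. ca h \<le> cb h \<Longrightarrow> card {r \<in> S. b r = h} \<le> card {r \<in> R. a r = h \<and> b r \<noteq> h}"
    and "refilled_sources \<noteq> {}"
  shows "(\<forall>r\<in>S. additive (a r)) \<Longrightarrow> 1 + real (card S) / real (card R) \<le> total ca"
    and "(\<exists>r\<in>S. \<not> additive (a r)) \<Longrightarrow> 2 \<le> total ca"
proof -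
  have fS: "finite S" using S finite_R finite_subset by blast
  have F: "ca f \<le> cb f" "l f \<le> cb f" "f \<in> H" if "f \<in> refilled_sources" for f
    using that a_in by (auto simp: refilled_sources_def)
  have w: "1 / real (card R) \<le> weight r" if "r \<in> R" "additive (a r)" for r
    using that quota_le[OF a_in[OF that(1)]] by (auto simp: additive_def frac_le)
  have wS: "real (card X) / real (card R) \<le> (\<Sum>r\<in>X. weight r)" if "X \<subseteq> S" "\<forall>r\<in>S. additive (a r)" for X
  proof -
    have "(\<Sum>r\<in>X. 1 / real (card R)) \<le> (\<Sum>r\<in>X. weight r)"
      using that S w by (intro sum_mono) blast
    then show ?thesis by simp
  qed
  have non: "l (a r) \<le> ca (a r)" if "\<not> additive (a r)" for r
    using that by (auto simp: additive_def)
  have "((\<forall>r\<in>S. additive (a r)) \<longrightarrow> 1 + real (card S) / real (card R) \<le> total ca) \<and>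
    ((\<exists>r\<in>S. \<not> additive (a r)) \<longrightarrow> 2 \<le> total ca)"
  proof (cases "\<exists>f \<in> refilled_sources. l f \<le> ca f")
    case True
    then obtain f where f: "f \<in> refilled_sources" "l f \<le> ca f" by blast
    have nf: "a r \<noteq> f" if "r \<in> S" for r using S(2)[OF that] F(1)[OF f(1)] by auto
    have "1 + real (card S) / real (card R) \<le> total ca" if add: "\<forall>r\<in>S. additive (a r)"
    proof -
      have "real (card {f}) + (\<Sum>r\<in>S. weight r) \<le> total ca"
        using f(2) F(3)[OF f(1)] S(1) nf add by (intro total_lower) auto
      then show ?thesis using wS[OF order_refl add] by simp
    qed
    moreover have "2 \<le> total ca" if "r \<in> S" "\<not> additive (a r)" for r
    proof -
      have "real (card {f, a r}) + (\<Sum>r\<in>{}. weight r) \<le> total ca"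
        using f(2) F(3)[OF f(1)] S(1) that a_in[of r] non[of r] by (intro total_lower) auto
      then show ?thesis using nf[OF that(1)] by simp
    qed
    ultimately show ?thesis by blast
  next
    case False
    then have short: "ca f < l f" if "f \<in> refilled_sources" for f using that by force
    have gF: "gains f" if "f \<in> refilled_sources" for f
      using F(2)[OF that] short[OF that] by (simp add: gains_def)
    have "refilled_sources \<subseteq> H" using F(3) by blast
    then have "finite refilled_sources" using finite_H finite_subset by blast
    then have fin: "finite (l ` refilled_sources)" "l ` refilled_sources \<noteq> {}" using assms(4) by auto
    then obtain f where f: "f \<in> refilled_sources" and lf_Max: "l f = Max (l ` refilled_sources)"
      using Max_in[OF fin] by (metis imageE)
    have fmax: "l g \<le> l f" if "g \<in> refilled_sources" for g
      using that fin lf_Max by simp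
    define W where "W = {r \<in> R. a r \<in> refilled_sources \<or> b r \<in> refilled_sources}"
    have WR: "W \<subseteq> R" "finite W" using finite_R by (auto simp: W_def)
    have W: "additive (a r)" "1 / real (l f) \<le> weight r" if r: "r \<in> W" for r
    proof -
      have "additive (a r) \<and> l (a r) \<le> l f"
      proof (cases "a r \<in> refilled_sources")
        case True
        then show ?thesis using short[OF True] fmax[OF True] by (simp add: additive_def)
      next
        case False
        with r have "b r \<in> refilled_sources" by (simp add: W_def)
        then show ?thesis
          using gain_cases(1,2)[of r] False r gF fmax[of "b r"] by (fastforce simp: W_def)
      qed
      then show "additive (a r)" "1 / real (l f) \<le> weight r" by (auto simp: additive_def frac_le)
    qed
    have lf: "l f > 0" using short[OF f] by simp
    have sumW: "real (card W) / real (l f) \<le> (\<Sum>r\<in>W. weight r)"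
      using sum_mono[of W "\<lambda>_. 1 / real (l f)" weight] W(2) by simp
    \<comment> \<open>\<open>?A\<close>, \<open>?B\<close> and \<open>?C\<close> are disjoint parts
      of \<open>W\<close>. \<open>?A\<close> has \<open>cb f \<ge> l f\<close> members.
      \<open>?B\<close> and \<open>?C\<close> together match \<open>W \<inter> S\<close>: nobody in
      \<open>S\<close> starts in a refilled source, and by \<open>through\<close> those entering
      \<open>f\<close> are at most as many as the leavers in \<open>?C\<close>.\<close>
    have cardW: "l f + card (W \<inter> S) \<le> card W"
    proof -
      let ?A = "{r \<in> R. b r = f}" and ?B = "{r \<in> S. b r \<in> refilled_sources - {f}}"
      let ?C = "{r \<in> R. a r = f \<and> b r \<noteq> f}"
      have aS: "a r \<notin> refilled_sources" if "r \<in> S" for r using S(2)[OF that] F(1) by force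
      have "W \<inter> S \<subseteq> ?B \<union> {r \<in> S. b r = f}" using aS by (auto simp: W_def)
      then have "card (W \<inter> S) \<le> card (?B \<union> {r \<in> S. b r = f})"
        using fS by (intro card_mono) auto
      also have "\<dots> \<le> card ?B + card {r \<in> S. b r = f}" by (rule card_Un_le)
      also have "\<dots> \<le> card ?B + card ?C" using through[OF F(1)[OF f]] by simp
      finally have 1: "card (W \<inter> S) \<le> card ?B + card ?C" .
      have "card ?A + card ?B + card ?C = card (?A \<union> ?B \<union> ?C)"
      proof -
        have "card (?A \<union> ?B \<union> ?C) = card (?A \<union> ?B) + card ?C"
          using finite_R fS aS f by (intro card_Un_disjoint) auto
        also have "card (?A \<union> ?B) = card ?A + card ?B"
          using finite_R fS by (intro card_Un_disjoint) auto
        finally show ?thesis by simp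
      qed
      also have "\<dots> \<le> card W" using S(1) WR(2) f by (intro card_mono) (auto simp: W_def)
      finally show ?thesis using 1 F(2)[OF f] by (simp add: cb_def)
    qed
    then have "real (l f) + real (card (W \<inter> S)) \<le> real (card W)" by linarith
    then have "(real (l f) + real (card (W \<inter> S))) / real (l f) \<le> real (card W) / real (l f)"
      by (rule divide_right_mono) simp
    then have W1: "1 + real (card (W \<inter> S)) / real (l f) \<le> real (card W) / real (l f)"
      using lf by (simp add: add_divide_distrib)
    have "1 + real (card S) / real (card R) \<le> total ca" if add: "\<forall>r\<in>S. additive (a r)"
    proof -
      have "real (card S) = real (card (W \<inter> S)) + real (card (S - W))"
        using fS by (metis Int_commute card_Int_Diff of_nat_add)
      then have "real (card S) / real (card R) = real (card (W \<inter> S)) / real (card R) + real (card (S - W)) / real (card R)"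
        by (simp add: add_divide_distrib)
      \<comment> \<open>Within \<open>W\<close> the share \<open>1 / l f\<close> is at least
        \<open>1 / card R\<close>; outside \<open>W\<close> each weight is.\<close>
      also have "\<dots> \<le> real (card (W \<inter> S)) / real (l f) + (\<Sum>r\<in>S - W. weight r)"
        using lf quota_le[OF F(3)[OF f]] by (intro add_mono wS[OF _ add] divide_left_mono) auto
      finally have "1 + real (card S) / real (card R) \<le> (\<Sum>r\<in>W. weight r) + (\<Sum>r\<in>S - W. weight r)"
        using W1 sumW by linarith
      also have "\<dots> = (\<Sum>r\<in>W \<union> (S - W). weight r)"
        using WR fS by (subst sum.union_disjoint) auto
      also have "\<dots> \<le> total ca"
        using total_lower[of "{}" "W \<union> (S - W)"] WR(1) S(1) W(1) add by auto
      finally show ?thesis .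
    qed
    moreover have "2 \<le> total ca" if r: "r \<in> S" "\<not> additive (a r)" for r
    proof -
      have "1 + (\<Sum>r\<in>W. weight r) \<le> total ca"
      proof -
        \<comment> \<open>All of \<open>W\<close> starts in additive hospitals, so
          \<open>a r\<close>, which has score 1 because it is not additive, counts on top of the
          weight of \<open>W\<close>.\<close>
        have "a r' \<noteq> a r" if "r' \<in> W" for r'
          using W(1)[OF that] r(2) by auto
        then have "real (card {a r}) + (\<Sum>r\<in>W. weight r) \<le> total ca"
          using r S(1) W(1) WR(1) a_in[of r] non[of r] by (intro total_lower) auto
        then show ?thesis by simp
      qed
      moreover have "0 \<le> real (card (W \<inter> S)) / real (l f)" by simp
      ultimately show ?thesis using W1 sumW by linarith
    qed
    ultimately show ?thesis by blast
  qed
  then show "(\<forall>r\<in>S. additive (a r)) \<Longrightarrow> 1 + real (card S) / real (card R) \<le> total ca"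
    and "(\<exists>r\<in>S. \<not> additive (a r)) \<Longrightarrow> 2 \<le> total ca" by blast+
qed

text \<open>Splits the changes in \<open>quota_score_diff\<close> into equal shares, one for each
  resident of \<open>E\<close> entering and of \<open>S\<close> leaving the hospital.\<close>

lemma total_diff:
  assumes E: "finite E" "\<And>h. card {r \<in> E. b r = h} = cb h - ca h" "b ` E \<subseteq> H"
    and S: "finite S" "\<And>h. card {r \<in> S. a r = h} = ca h - cb h" "a ` S \<subseteq> H"
  shows "total cb - total ca
    \<le> (\<Sum>r\<in>E. if gains (b r) then 1 / real (l (b r)) else 0)
      - (\<Sum>r\<in>S. if additive (a r) then weight r else 0)"
proof -
  have "(\<Sum>r\<in>E. if gains (b r) then 1 / real (l (b r)) else 0)
    = (\<Sum>h\<in>H. \<Sum>r\<in>{r\<in>E. b r = h}. if gains (b r) then 1 / real (l (b r)) else 0)"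
    using E finite_H by (subst sum.group) auto
  also have "\<dots> = (\<Sum>h\<in>H. \<Sum>r\<in>{r\<in>E. b r = h}. if gains h then 1 / real (l h) else 0)"
    by (intro sum.cong) auto
  also have "\<dots> = (\<Sum>h\<in>H. if gains h then real (cb h - ca h) / real (l h) else 0)"
    by (intro sum.cong) (auto simp: E(2))
  finally have 1: "(\<Sum>r\<in>E. if gains (b r) then 1 / real (l (b r)) else 0)
    = (\<Sum>h\<in>H. if gains h then real (cb h - ca h) / real (l h) else 0)" .
  have "(\<Sum>r\<in>S. if additive (a r) then weight r else 0)
    = (\<Sum>h\<in>H. \<Sum>r\<in>{r\<in>S. a r = h}. if additive (a r) then weight r else 0)"
    using S finite_H by (subst sum.group) auto
  also have "\<dots> = (\<Sum>h\<in>H. \<Sum>r\<in>{r\<in>S. a r = h}. if additive h then 1 / real (l h) else 0)"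
    by (intro sum.cong) auto
  also have "\<dots> = (\<Sum>h\<in>H. if additive h then real (ca h - cb h) / real (l h) else 0)"
    by (intro sum.cong) (auto simp: S(2))
  finally have 2: "(\<Sum>r\<in>S. if additive (a r) then weight r else 0)
    = (\<Sum>h\<in>H. if additive h then real (ca h - cb h) / real (l h) else 0)" .
  have "total cb - total ca = (\<Sum>h\<in>H. quota_score (l h) (cb h) - quota_score (l h) (ca h))"
    by (simp add: sum_subtractf)
  also have "\<dots> \<le> (\<Sum>h\<in>H. (if gains h then real (cb h - ca h) / real (l h) else 0)
     - (if additive h then real (ca h - cb h) / real (l h) else 0))"
    by (intro sum_mono quota_score_diff)
  finally show ?thesis unfolding 1 2 sum_subtractf .
qed

section \<open>The ratio of the two totals\<close>

lemma sum_counts: "(\<Sum>h\<in>H. ca h) = card R" "(\<Sum>h\<in>H. cb h) = card R"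
  using finite_R finite_H a_in b_in sum.group[of R H a "\<lambda>_. 1::nat"] sum.group[of R H b "\<lambda>_. 1::nat"]
  by (auto simp: ca_def cb_def)

text \<open>
  \<open>E\<close> and \<open>S\<close> pick out the net change of every hospital. Residents in both pay for their own
  gain, so only \<open>E - S\<close> and \<open>S - E\<close> matter, which are disjoint and of the same size.
\<close>
lemma total_ratio:
  obtains x where "2 * x \<le> card R"
    "total cb * (1 + real x / real (card R)) \<le> (1 + real x) * total ca
      \<or> total cb \<le> (1 + real x / 2) * total ca"
proof -
  obtain E S where E: "E \<subseteq> {r \<in> R. a r \<noteq> b r}" "\<And>h. card {r \<in> E. b r = h} = cb h - ca h"
    and S: "S \<subseteq> {r \<in> R. a r \<noteq> b r}" "\<And>h. card {r \<in> S. a r = h} = ca h - cb h"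
    using surplus_entrants surplus_leavers by blast
  have fE: "finite E" and fS: "finite S" using E(1) S(1) finite_R by (auto intro: finite_subset)
  have bE: "b ` E \<subseteq> H" and aS: "a ` S \<subseteq> H" using E(1) S(1) a_in b_in by auto
  have cE: "cb (b r) > ca (b r)" if "r \<in> E" for r
  proof -
    have "card {r' \<in> E. b r' = b r} > 0" using that fE by (auto simp: card_gt_0_iff)
    then show ?thesis using E(2)[of "b r"] by simp
  qed
  have cS: "cb (a r) < ca (a r)" if "r \<in> S" for r
  proof -
    have "card {r' \<in> S. a r' = a r} > 0" using that fS by (auto simp: card_gt_0_iff)
    then show ?thesis using S(2)[of "a r"] by simp
  qed
  have "card E = (\<Sum>h\<in>H. cb h - ca h)"
    using sum.group[OF fE finite_H bE, of "\<lambda>_. 1::nat"] by (simp add: E(2))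
  moreover have "card S = (\<Sum>h\<in>H. ca h - cb h)"
    using sum.group[OF fS finite_H aS, of "\<lambda>_. 1::nat"] by (simp add: S(2))
  \<comment> \<open>With truncated subtraction both summands equal
    \<open>max (ca h) (cb h)\<close>.\<close>
  moreover have "(\<Sum>h\<in>H. cb h - ca h) + (\<Sum>h\<in>H. ca h) = (\<Sum>h\<in>H. ca h - cb h) + (\<Sum>h\<in>H. cb h)"
    unfolding sum.distrib[symmetric] by (intro sum.cong) auto
  ultimately have ES: "card E = card S" by (simp add: sum_counts)
  define Y where "Y = E - S"
  define Z where "Z = S - E"
  define x where "x = card Z"
  have fYZ: "finite Y" "finite Z" "Y \<inter> Z = {}" "Y \<subseteq> R" "Z \<subseteq> R"
    using fE fS E(1) S(1) by (auto simp: Y_def Z_def)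
  have Yx: "card Y = x"
    using ES fE fS unfolding Y_def Z_def x_def by (metis add_left_cancel card_Int_Diff Int_commute)
  have "card (Y \<union> Z) \<le> card R" using fYZ finite_R by (intro card_mono) auto
  then have x2: "2 * x \<le> card R" using fYZ Yx by (simp add: card_Un_disjoint x_def)
  have n: "real (card R) \<ge> 1" using finite_R R_nonempty by (simp add: Suc_leI card_gt_0_iff)
  define Yg where "Yg = {r \<in> Y. gains (b r)}"
  define g where "g = (\<Sum>r\<in>Yg. 1 / real (l (b r)))"
  define L where "L = (\<Sum>r\<in>Z. if additive (a r) then weight r else 0)"
  \<comment> \<open>The source of a resident of \<open>S\<close> shrinks, so it is not refilled and
    \<open>gain_cases\<close> applies.\<close>
  have "(\<Sum>r\<in>E \<inter> S. if gains (b r) then 1 / real (l (b r)) else 0)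
      \<le> (\<Sum>r\<in>E \<inter> S. if additive (a r) then weight r else 0)"
  proof (rule sum_mono)
    fix r assume r: "r \<in> E \<inter> S"
    show "(if gains (b r) then 1 / real (l (b r)) else 0) \<le> (if additive (a r) then weight r else 0)"
    proof (cases "gains (b r)")
      case True
      have "a r \<notin> refilled_sources" using cS[of r] r by (auto simp: refilled_sources_def)
      then show ?thesis using True gain_cases[of r] r E(1) by auto
    qed auto
  qed
  moreover have "(\<Sum>r\<in>E. if gains (b r) then 1 / real (l (b r)) else 0)
    = (\<Sum>r\<in>E \<inter> S. if gains (b r) then 1 / real (l (b r)) else 0) + g"
  proof -
    have "g = (\<Sum>r\<in>Y. if gains (b r) then 1 / real (l (b r)) else 0)"
      using fYZ(1) unfolding g_def Yg_def by (simp add: sum.inter_filter)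
    then show ?thesis using sum.Int_Diff[OF fE, of _ S] by (simp add: Y_def)
  qed
  moreover have "(\<Sum>r\<in>S. if additive (a r) then weight r else 0)
    = (\<Sum>r\<in>E \<inter> S. if additive (a r) then weight r else 0) + L"
    using sum.Int_Diff[OF fS, of _ E] by (simp add: L_def Z_def Int_commute)
  ultimately have diff: "total cb \<le> total ca + g - L"
    using total_diff[OF fE E(2) bE fS S(2) aS] by linarith
  have YgY: "Yg \<subseteq> Y" by (auto simp: Yg_def)
  have "g \<le> (\<Sum>r\<in>Yg. 1)"
    unfolding g_def Yg_def by (rule sum_mono) (auto simp: gains_def)
  also have "\<dots> \<le> real x"
    using Yx card_mono[OF fYZ(1) YgY] by simp
  finally have gx: "g \<le> real x" .
  have L0: "L \<ge> 0" unfolding L_def by (intro sum_nonneg) auto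
  have ca0: "0 \<le> total ca" by (intro sum_nonneg quota_score_nonneg)
  \<comment> \<open>Entrants of \<open>h\<close> in \<open>Z\<close> lie outside \<open>E\<close>,
    which holds exactly \<open>cb h - ca h\<close> entrants; by \<open>in_out_balance\<close> the
    other entrants are as many as the leavers.\<close>
  have through: "card {r \<in> Z. b r = h} \<le> card {r \<in> R. a r = h \<and> b r \<noteq> h}" if "ca h \<le> cb h" for h
  proof -
    have sub: "{r \<in> E. b r = h} \<subseteq> {r \<in> R. b r = h \<and> a r \<noteq> h}" using E(1) by auto
    have "card {r \<in> Z. b r = h} \<le> card ({r \<in> R. b r = h \<and> a r \<noteq> h} - {r \<in> E. b r = h})"
      using finite_R S(1) by (intro card_mono) (auto simp: Z_def)
    also have "\<dots> = card {r \<in> R. b r = h \<and> a r \<noteq> h} - (cb h - ca h)"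
      using fE sub by (subst card_Diff_subset) (auto simp: E(2))
    also have "\<dots> = card {r \<in> R. a r = h \<and> b r \<noteq> h}"
      using in_out_balance[of h] that by simp
    finally show ?thesis .
  qed
  have tied: "additive (a r)" "1 / real (l (b r)) \<le> weight r"
    if "r \<in> Yg" "refilled_sources = {}" for r
    using that gain_cases[of r] E(1) by (auto simp: Yg_def Y_def)
  have g_tied: "g \<le> (\<Sum>r\<in>Yg. weight r)" if "refilled_sources = {}"
    unfolding g_def using tied that by (intro sum_mono) auto
  show ?thesis
  proof (cases "\<forall>r\<in>Z. additive (a r)")
    case True
    then have Lw: "L = (\<Sum>r\<in>Z. weight r)" unfolding L_def by (intro sum.cong) auto
    have "(\<Sum>r\<in>Z. 1 / real (card R)) \<le> L" unfolding Lw
    proof (rule sum_mono)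
      fix r assume "r \<in> Z"
      then have "additive (a r)" "a r \<in> H" using True fYZ a_in by auto
      then show "1 / real (card R) \<le> weight r"
        using quota_le[of "a r"] by (auto simp: additive_def frac_le)
    qed
    then have xL: "real x / real (card R) \<le> L" by (simp add: x_def)
    define q where "q = real x / real (card R)"
    have qx: "q \<le> real x" "0 \<le> q" using n by (auto simp: q_def divide_le_eq mult_le_cancel_left1)
    \<comment> \<open>This says that \<open>total ca + g - L\<close>, the bound on
      \<open>total cb\<close> from \<open>diff\<close>, satisfies the first alternative of the
      conclusion.\<close>
    have key: "(g - L) * (1 + q) \<le> (real x - q) * total ca"
    proof (cases "refilled_sources = {}")
      case False
      have "1 + q \<le> total ca"
        unfolding q_def x_def using refilled_sources_bound(1)[of Z] fYZ cS through False True
        by (auto simp: Z_def)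
      moreover have "(g - L) * (1 + q) \<le> (real x - q) * (1 + q)"
        using gx xL qx by (intro mult_right_mono) (auto simp: q_def)
      ultimately show ?thesis using qx by (meson diff_ge_0_iff_ge mult_left_mono order_trans)
    next
      case e: True
      \<comment> \<open>With no refilled source, the members of \<open>Yg\<close> and
        \<open>Z\<close> all start in additive hospitals and are disjoint, so their weights add up
        within \<open>total ca\<close>.\<close>
      have "real (card ({} :: 'h set)) + (\<Sum>r\<in>Yg \<union> Z. weight r) \<le> total ca"
        using YgY fYZ tied[OF _ e] True by (intro total_lower) auto
      moreover have "(\<Sum>r\<in>Yg \<union> Z. weight r) = (\<Sum>r\<in>Yg. weight r) + (\<Sum>r\<in>Z. weight r)"
        using YgY fYZ by (intro sum.union_disjoint) (auto intro: finite_subset)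
      ultimately have s: "g + L \<le> total ca" using g_tied[OF e] Lw by simp
      show ?thesis
      proof (cases "x = 0")
        case True
        then show ?thesis using gx L0 by (simp add: q_def)
      next
        case False
        then have x1: "real x \<ge> 1" by simp
        have "(g - L) * (1 + q) \<le> (real x - q) * (g + L)"
        proof -
          \<comment> \<open>A rearrangement of the surrounding goal. The worst case is
            \<open>g = x\<close> and \<open>L = q\<close>, where \<open>x = q * card R\<close>
            reduces it to \<open>q * (card R - 1) * (x - 1) \<ge> 0\<close>.\<close>
          have "g * (1 + 2 * q - real x) \<le> L * (1 + real x)"
          proof (cases "1 + 2 * q - real x \<le> 0")
            case True
            have "0 \<le> g" unfolding g_def by (intro sum_nonneg) auto
            with True have "g * (1 + 2 * q - real x) \<le> 0" by (simp add: mult_nonneg_nonpos)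
            also have "0 \<le> L * (1 + real x)" using L0 by simp
            finally show ?thesis .
          next
            case False
            then have "g * (1 + 2 * q - real x) \<le> real x * (1 + 2 * q - real x)"
              using gx by (intro mult_right_mono) auto
            also have "\<dots> \<le> q * (1 + real x)"
            proof -
              have "real x = q * real (card R)" using n by (simp add: q_def)
              moreover have "q * ((real (card R) - 1) * (real x - 1)) \<ge> 0" using n x1 qx by simp
              ultimately show ?thesis by (simp add: algebra_simps)
            qed
            also have "\<dots> \<le> L * (1 + real x)" using xL by (intro mult_right_mono) (auto simp: q_def)
            finally show ?thesis .
          qed
          then show ?thesis by (simp add: algebra_simps)
        qed
        also have "\<dots> \<le> (real x - q) * total ca" using s qx by (intro mult_left_mono) auto
        finally show ?thesis .
      qed
    qed
    have "total cb * (1 + q) \<le> (total ca + g - L) * (1 + q)"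
      using diff qx by (intro mult_right_mono) auto
    also have "\<dots> = total ca * (1 + q) + (g - L) * (1 + q)" by (simp add: algebra_simps)
    also have "\<dots> \<le> (1 + real x) * total ca" using key by (simp add: algebra_simps)
    finally show ?thesis using that[OF x2] by (simp add: q_def)
  next
    case False
    then obtain z where z: "z \<in> Z" "\<not> additive (a z)" by blast
    then have "0 < card Z" using fYZ(2) by (auto simp: card_gt_0_iff)
    then have x1: "real x \<ge> 1" by (simp add: x_def)
    \<comment> \<open>The hospital \<open>a z\<close> is not additive and so has score 1. Refilled
      sources, if any, raise the total to at least 2; otherwise the weights of \<open>Yg\<close> add
      at least \<open>g\<close>.\<close>
    have "g \<le> (real x / 2) * total ca"
    proof (cases "refilled_sources = {}")
      case False
      have "2 \<le> total ca"
        using refilled_sources_bound(2)[of Z] fYZ cS through False z by (auto simp: Z_def)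
      then have "(real x / 2) * 2 \<le> (real x / 2) * total ca" by (intro mult_left_mono) auto
      then show ?thesis using gx by simp
    next
      case e: True
      have "real (card {a z}) + (\<Sum>r\<in>Yg. weight r) \<le> total ca"
      proof (rule total_lower)
        show "a r \<notin> {a z}" if "r \<in> Yg" for r using tied(1)[OF that e] z(2) by auto
        show "l h \<le> ca h" if "h \<in> {a z}" for h using that z(2) by (auto simp: additive_def)
        show "{a z} \<subseteq> H" "Yg \<subseteq> R" using z(1) fYZ YgY a_in by auto
      qed (use tied(1)[OF _ e] in auto)
      then have s: "1 + g \<le> total ca" using g_tied[OF e] by simp
      show ?thesis
      proof (cases "x = 1")
        case True
        \<comment> \<open>Here \<open>g \<le> 1\<close> gives
          \<open>2 * g \<le> 1 + g\<close>.\<close>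
        then show ?thesis using s gx by simp
      next
        case False
        with x1 have "1 \<le> real x / 2" by simp
        then have "1 * total ca \<le> (real x / 2) * total ca" using ca0 by (intro mult_right_mono)
        then show ?thesis using s by simp
      qed
    qed
    then have "total cb \<le> (1 + real x / 2) * total ca"
      using diff L0 by (simp add: algebra_simps)
    then show ?thesis using that[OF x2] by blast
  qed
qed

end

section \<open>Double Proposal\<close>

definition tied :: "hrt_instance \<Rightarrow> nat \<Rightarrow> nat \<Rightarrow> nat \<Rightarrow> bool" where
  "tied I r h h' \<longleftrightarrow> (h, h') \<in> rpref I r \<and> (h', h) \<in> rpref I r"

text \<open>The preference of \<open>h\<close> with ties broken by smaller index, as the algorithm does when deleting.\<close>
definition beats :: "hrt_instance \<Rightarrow> nat \<Rightarrow> nat \<Rightarrow> nat \<Rightarrow> bool" where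
  "beats I h x y \<longleftrightarrow> (x, y) \<in> hpref I h \<and> ((y, x) \<in> hpref I h \<longrightarrow> x < y)"

lemma total_preorder_onD:
  assumes "total_preorder_on A p"
  shows "\<And>x. x \<in> A \<Longrightarrow> (x, x) \<in> p" "trans p" "\<And>x y. x \<in> A \<Longrightarrow> y \<in> A \<Longrightarrow> (x, y) \<in> p \<or> (y, x) \<in> p"
    "p \<subseteq> A \<times> A"
  using assms unfolding total_preorder_on_def preorder_on_def total_on_def refl_on_def by metis+

lemma finite_total_preorder_top:
  assumes p: "total_preorder_on A p" and "finite S" "S \<noteq> {}" "S \<subseteq> A"
  shows "\<exists>m\<in>S. \<forall>x\<in>S. (m, x) \<in> p"
  using assms(2-)
proof (induction S rule: finite_ne_induct)
  case (singleton x)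
  then show ?case using total_preorder_onD(1)[OF p] by auto
next
  case (insert x F)
  then obtain m where m: "m \<in> F" "\<forall>y\<in>F. (m, y) \<in> p" by auto
  show ?case
  proof (cases "(m, x) \<in> p")
    case True
    then show ?thesis using m by blast
  next
    case False
    then have "(x, m) \<in> p" using insert.prems m total_preorder_onD(3)[OF p] by blast
    then have "\<forall>y\<in>F. (x, y) \<in> p" using m total_preorder_onD(2)[OF p] by (meson transD)
    then show ?thesis using insert.prems total_preorder_onD(1)[OF p] by blast
  qed
qed

lemma finite_total_preorder_bottom:
  assumes "total_preorder_on A p" "finite S" "S \<noteq> {}" "S \<subseteq> A"
  shows "\<exists>m\<in>S. \<forall>x\<in>S. (x, m) \<in> p"
proof -
  have "total_preorder_on A (p\<inverse>)"
    using assms(1) by (auto simp: total_preorder_on_def preorder_on_def refl_on_def total_on_def)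
  from finite_total_preorder_top[OF this assms(2-)] show ?thesis by simp
qed

lemma beats_trans:
  assumes "trans (hpref I h)" "beats I h x y" "beats I h y z"
  shows "beats I h x z"
proof -
  have "(x, z) \<in> hpref I h" using assms by (meson beats_def transD)
  moreover have "x < z" if "(z, x) \<in> hpref I h"
  proof -
    have "(z, y) \<in> hpref I h" "(y, x) \<in> hpref I h"
      using that assms by (meson beats_def transD)+
    then show ?thesis using assms by (auto simp: beats_def)
  qed
  ultimately show ?thesis by (simp add: beats_def)
qed

lemma worst_resident_props:
  assumes p: "total_preorder_on A (hpref I h)" and S: "finite S" "S \<noteq> {}" "S \<subseteq> A"
  shows "worst_resident I h S \<in> S"
    and "\<And>x. x \<in> S \<Longrightarrow> x \<noteq> worst_resident I h S \<Longrightarrow> beats I h x (worst_resident I h S)"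
proof -
  let ?W = "{r \<in> S. \<forall>r'\<in>S. (r', r) \<in> hpref I h}"
  have W: "finite ?W" "?W \<noteq> {}" using S finite_total_preorder_bottom[OF p S] by auto
  have w: "worst_resident I h S \<in> ?W" unfolding worst_resident_def by (rule Max_in[OF W])
  then show "worst_resident I h S \<in> S" by simp
  fix x assume x: "x \<in> S" "x \<noteq> worst_resident I h S"
  have "x \<le> worst_resident I h S" if "(worst_resident I h S, x) \<in> hpref I h"
  proof -
    have "x \<in> ?W" using that x w total_preorder_onD(2)[OF p] by (auto dest: transD)
    then show ?thesis unfolding worst_resident_def using W by (intro Max_ge) auto
  qed
  then show "beats I h x (worst_resident I h S)" using x w by (fastforce simp: beats_def)
qed

lemma min_lower_props:
  assumes "finite A" "A \<noteq> {}"
  shows "min_lower I A \<in> A" "\<And>x. x \<in> A \<Longrightarrow> lower I (min_lower I A) \<le> lower I x"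
proof -
  let ?L = "{h \<in> A. \<forall>h'\<in>A. lower I h \<le> lower I h'}"
  obtain m where "m \<in> A" "lower I m = Min (lower I ` A)"
    using Min_in[of "lower I ` A"] assms by (metis finite_imageI image_is_empty imageE)
  then have "m \<in> ?L" using assms by simp
  then have "min_lower I A \<in> ?L" unfolding min_lower_def using assms by (intro Min_in) auto
  then show "min_lower I A \<in> A" "\<And>x. x \<in> A \<Longrightarrow> lower I (min_lower I A) \<le> lower I x" by auto
qed

lemma finite_residents [simp]: "finite (residents I)" and finite_hospitals [simp]: "finite (hospitals I)"
  by (auto simp: residents_def hospitals_def)

lemma finite_ress_of: "M \<subseteq> residents I \<times> hospitals I \<Longrightarrow> finite (ress_of M h)"
  by (rule finite_subset[of _ "residents I"]) (auto simp: ress_of_def)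

lemma sum_card_ress_of:
  assumes "M \<subseteq> residents I \<times> hospitals I"
  shows "(\<Sum>h\<in>hospitals I. card (ress_of M h)) = card M"
proof -
  have "finite M" using assms by (rule finite_subset) simp
  have "card (ress_of M h) = card {x \<in> M. snd x = h}" for h
    by (rule bij_betw_same_card[of "\<lambda>r. (r, h)"]) (auto simp: bij_betw_def ress_of_def inj_on_def)
  then show ?thesis
    using sum.group[of M "hospitals I" snd "\<lambda>_. 1::nat"] assms \<open>finite M\<close> by fastforce
qed

text \<open>The total upper quota exceeds the number of residents, which bounds the number of pairs.
  This keeps the lists of unmatched residents nonempty and forces stable matchings to match
  everybody.\<close>

lemma some_hospital_not_full:
  assumes I: "hrt_mslq I" and M: "M \<subseteq> residents I \<times> hospitals I"
    and func: "\<And>r h h'. (r, h) \<in> M \<Longrightarrow> (r, h') \<in> M \<Longrightarrow> h = h'"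
  shows "\<exists>h\<in>hospitals I. card (ress_of M h) < upper I h"
proof (rule ccontr)
  assume "\<not> ?thesis"
  then have "(\<Sum>h\<in>hospitals I. upper I h) \<le> card M"
    unfolding sum_card_ress_of[OF M, symmetric] by (intro sum_mono) force
  also have "card M = card (fst ` M)"
    using func by (intro card_image[symmetric]) (auto simp: inj_on_def)
  also have "\<dots> \<le> card (residents I)" using M by (intro card_mono) auto
  also have "\<dots> = num_residents I" by (simp add: residents_def)
  finally show False using I by (simp add: hrt_mslq_def)
qed

text \<open>
  \<open>second_proposal\<close>: a resident returns to a hospital that has rejected it only after all hospitals
  of the tie have done so.
\<close>
locale dp_invariant =
  fixes I :: hrt_instance and s :: dp_state
  assumes asg_subset: "asg s \<subseteq> residents I \<times> hospitals I"
    and asg_unique: "(r, h) \<in> asg s \<Longrightarrow> (r, h') \<in> asg s \<Longrightarrow> h = h'"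
    and upper_quota: "h \<in> hospitals I \<Longrightarrow> card (ress_of (asg s) h) \<le> upper I h"
    and proposed_subset: "proposed s \<subseteq> residents I \<times> hospitals I"
    and deleted_rejected: "deleted s \<subseteq> rejected s"
    and rejected_proposed: "rejected s \<subseteq> proposed s"
    and asg_proposed: "asg s \<subseteq> proposed s"
    and proposed_cases: "proposed s \<subseteq> asg s \<union> rejected s"
    and rejected_lower: "(r, h) \<in> rejected s \<Longrightarrow> lower I h \<le> card (ress_of (asg s) h)"
    and surplus_rejected: "lower I h < card (ress_of (asg s) h) \<Longrightarrow> (r, h) \<in> asg s \<Longrightarrow> (r, h) \<in> rejected s"
    and deleted_full: "(r, h) \<in> deleted s \<Longrightarrow> card (ress_of (asg s) h) = upper I h"
    and deleted_all_rejected: "(r, h) \<in> deleted s \<Longrightarrow> (r', h) \<in> asg s \<Longrightarrow> (r', h) \<in> rejected s"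
    and deleted_beaten: "(r, h) \<in> deleted s \<Longrightarrow> (r', h) \<in> asg s \<Longrightarrow> beats I h r' r"
    and asg_top: "(r, h) \<in> asg s \<Longrightarrow> h' \<in> hospitals I \<Longrightarrow> (r, h') \<notin> deleted s \<Longrightarrow> (h, h') \<in> rpref I r"
    and smaller_quota_first:
      "(r, h) \<in> proposed s \<Longrightarrow> tied I r h h' \<Longrightarrow> lower I h' < lower I h \<Longrightarrow> (r, h') \<in> rejected s"
    and second_proposal:
      "(r, h) \<in> asg s \<Longrightarrow> (r, h) \<in> rejected s \<Longrightarrow> tied I r h h' \<Longrightarrow> (r, h') \<in> rejected s"

section \<open>Preservation of the invariant\<close>

lemma dp_invariant_init: "hrt_mslq I \<Longrightarrow> dp_invariant I dp_init"
  by (simp add: dp_invariant_def dp_init_def ress_of_def)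

lemma hrt_mslqD:
  assumes "hrt_mslq I"
  shows "num_residents I \<ge> 1"
    "r \<in> residents I \<Longrightarrow> total_preorder_on (hospitals I) (rpref I r)"
    "h \<in> hospitals I \<Longrightarrow> total_preorder_on (residents I) (hpref I h)"
    "h \<in> hospitals I \<Longrightarrow> lower I h \<le> upper I h" "h \<in> hospitals I \<Longrightarrow> upper I h \<le> num_residents I"
    "h \<in> hospitals I \<Longrightarrow> 1 \<le> upper I h"
  using assms by (auto simp: hrt_mslq_def)

text \<open>The last two facts keep \<open>smaller_quota_first\<close> and
  \<open>second_proposal\<close> invariant.\<close>

lemma target_props:
  assumes I: "hrt_mslq I" and inv: "dp_invariant I s" and r: "r \<in> unmatched I s"
  defines "h \<equiv> target I s r"
  shows "h \<in> hospitals I" "(r, h) \<notin> deleted s"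
    "\<And>h'. h' \<in> hospitals I \<Longrightarrow> (r, h') \<notin> deleted s \<Longrightarrow> (h, h') \<in> rpref I r"
    "\<And>h'. tied I r h h' \<Longrightarrow> lower I h' < lower I h \<Longrightarrow> (r, h') \<in> rejected s"
    "\<And>h'. (r, h) \<in> proposed s \<Longrightarrow> tied I r h h' \<Longrightarrow> (r, h') \<in> rejected s"
proof -
  interpret dp_invariant I s by (rule inv)
  let ?L = "current_list I s r" and ?T = "top_tie I s r"
  let ?N = "{h \<in> ?T. (r, h) \<notin> proposed s}"
  have rR: "r \<in> residents I" and un: "\<And>h. (r, h) \<notin> asg s"
    using r by (auto simp: unmatched_def hosps_of_def)
  note p = hrt_mslqD(2)[OF I rR]
  obtain h0 where "h0 \<in> hospitals I" "card (ress_of (asg s) h0) < upper I h0"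
    using some_hospital_not_full[OF I asg_subset] asg_unique by blast
  \<comment> \<open>Deleted hospitals are full, so one with free capacity is still on the list of
    \<open>r\<close>.\<close>
  then have "h0 \<in> ?L" using deleted_full[of r h0] by (auto simp: current_list_def)
  then have ne: "?T \<noteq> {}"
    using finite_total_preorder_top[OF p, of ?L] by (fastforce simp: top_tie_def current_list_def)
  have fin: "finite ?T" by (rule finite_subset[of _ "hospitals I"]) (auto simp: top_tie_def current_list_def)
  \<comment> \<open>As \<open>r\<close> is unmatched, every hospital it has proposed to has rejected
    it.\<close>
  have rej: "(r, h') \<in> rejected s" if "(r, h') \<in> proposed s" for h'
    using that proposed_cases un by blast
  have h: "h = (if ?N \<noteq> {} then min_lower I ?N else min_lower I ?T)"
    by (simp add: h_def target_def Let_def)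
  have hN: "h \<in> ?N" "\<And>x. x \<in> ?N \<Longrightarrow> lower I h \<le> lower I x" if "?N \<noteq> {}"
    using min_lower_props[where A = ?N and I = I] that fin by (auto simp: h)
  have hT: "h \<in> ?T"
  proof (cases "?N = {}")
    case True
    then show ?thesis using min_lower_props(1)[OF fin ne] unfolding h by simp
  next
    case False
    then show ?thesis using hN(1) by blast
  qed
  then show "h \<in> hospitals I" "(r, h) \<notin> deleted s"
    "\<And>h'. h' \<in> hospitals I \<Longrightarrow> (r, h') \<notin> deleted s \<Longrightarrow> (h, h') \<in> rpref I r"
    by (auto simp: top_tie_def current_list_def)
  \<comment> \<open>A hospital tied with \<open>h\<close> is either deleted, and so has rejected
    \<open>r\<close>, or belongs to the top tie along with \<open>h\<close>.\<close>
  have tiedT: "(r, h') \<in> rejected s \<or> h' \<in> ?T" if t: "tied I r h h'" for h'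
  proof (cases "(r, h') \<in> deleted s")
    case True
    then show ?thesis using deleted_rejected by blast
  next
    case False
    have "h' \<in> hospitals I" using t total_preorder_onD(4)[OF p] by (auto simp: tied_def)
    moreover have "(h', x) \<in> rpref I r" if "x \<in> ?L" for x
      using t hT that total_preorder_onD(2)[OF p] unfolding tied_def top_tie_def by (blast dest: transD)
    ultimately show ?thesis using False by (auto simp: top_tie_def current_list_def)
  qed
  show "(r, h') \<in> rejected s" if "tied I r h h'" "lower I h' < lower I h" for h'
    using tiedT[OF that(1)] hN(2)[of h'] that(2) rej[of h'] by force
  show "(r, h') \<in> rejected s" if "(r, h) \<in> proposed s" "tied I r h h'" for h'
    using tiedT[OF that(2)] hN(1) that(1) rej[of h'] by force
qed

lemma ress_of_insert_diff:
  "ress_of (insert (r, h) M - Q \<times> {h}) h' = (if h' = h then insert r (ress_of M h) - Q else ress_of M h')"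
  by (auto simp: ress_of_def)

text \<open>
  All four cases of a proposal add \<open>r\<close> to \<open>h\<close>, then reject a set \<open>Q\<close> of at most one resident and delete
  \<open>h\<close> for the residents in \<open>X\<close>, which is \<open>Q\<close> or empty.
\<close>
definition dp_effect :: "hrt_instance \<Rightarrow> dp_state \<Rightarrow> nat \<Rightarrow> nat \<Rightarrow> nat set \<Rightarrow> nat set \<Rightarrow> bool" where
  "dp_effect I s r h Q X \<longleftrightarrow>
     (let M = ress_of (asg s) h; B = insert r M - Q in
       X \<subseteq> Q \<and> Q \<subseteq> insert r M \<and> card M \<le> card B \<and> card B \<le> upper I h \<and>
       (Q \<noteq> {} \<longrightarrow> lower I h \<le> card M) \<and>
       (lower I h < card B \<longrightarrow> (\<forall>x\<in>B. (x, h) \<in> rejected s)) \<and>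
       (\<forall>x. (x, h) \<in> deleted s \<or> x \<in> X \<longrightarrow>
          card B = upper I h \<and> (\<forall>y\<in>B. (y, h) \<in> rejected s \<and> beats I h y x)) \<and>
       (card M < card B \<or> \<not> Q \<times> {h} \<subseteq> rejected s \<or> \<not> X \<times> {h} \<subseteq> deleted s))"

lemma propose_effect:
  assumes I: "hrt_mslq I" and inv: "dp_invariant I s" and r: "r \<in> residents I" "\<And>h. (r, h) \<notin> asg s"
    and h: "h \<in> hospitals I" "(r, h) \<notin> deleted s"
  shows "\<exists>Q X. dp_effect I s r h Q X \<and>
    propose I r h s = s\<lparr>asg := insert (r, h) (asg s) - Q \<times> {h}, proposed := insert (r, h) (proposed s),
      rejected := rejected s \<union> Q \<times> {h}, deleted := deleted s \<union> X \<times> {h}\<rparr>"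
proof -
  interpret dp_invariant I s by (rule inv)
  let ?M = "ress_of (asg s) h"
  let ?A = "insert r ?M"
  let ?F = "{r' \<in> ?A. (r', h) \<notin> rejected s}"
  have fM: "finite ?M" using asg_subset by (rule finite_ress_of)
  have rM: "r \<notin> ?M" using r(2) by (simp add: ress_of_def)
  have cA: "card ?A = Suc (card ?M)" using fM rM by simp
  have lu: "lower I h \<le> upper I h" using hrt_mslqD(4)[OF I h(1)] .
  have Mu: "card ?M \<le> upper I h" using upper_quota[OF h(1)] .
  have over: "(x, h) \<in> rejected s" if "lower I h < card ?M" "x \<in> ?M" for x
    using surplus_rejected[OF that(1)] that(2) by (simp add: ress_of_def)
  have del: "card ?M = upper I h" "\<And>y. y \<in> ?M \<Longrightarrow> (y, h) \<in> rejected s \<and> beats I h y x"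
    if "(x, h) \<in> deleted s" for x
    using deleted_full[OF that] deleted_all_rejected[OF that] deleted_beaten[OF that] by (auto simp: ress_of_def)
  consider (1) "card ?M < lower I h" | (2) "lower I h \<le> card ?M" "?F \<noteq> {}"
    | (3) "lower I h \<le> card ?M" "?F = {}" "card ?M < upper I h"
    | (4) "lower I h \<le> card ?M" "?F = {}" "\<not> card ?M < upper I h"
    by linarith
  then show ?thesis
  proof cases
    case 1
    have "(x, h) \<notin> deleted s" for x using del(1)[of x] 1 lu by auto
    then have "dp_effect I s r h {} {}"
      using 1 lu cA by (simp add: dp_effect_def Let_def)
    moreover have "propose I r h s = s\<lparr>asg := insert (r, h) (asg s) - {} \<times> {h},
       proposed := insert (r, h) (proposed s),
       rejected := rejected s \<union> {} \<times> {h}, deleted := deleted s \<union> {} \<times> {h}\<rparr>"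
      using 1 by (simp add: propose_def Let_def)
    ultimately show ?thesis by blast
  next
    case 2
    define q where "q = Max ?F"
    have "q \<in> ?F" unfolding q_def using 2(2) fM by (intro Max_in) auto
    then have q: "q \<in> ?A" "(q, h) \<notin> rejected s" by simp_all
    have c: "card (?A - {q}) = card ?M" using q cA fM by (subst card_Diff_singleton) auto
    \<comment> \<open>If all residents in \<open>h\<close> have been rejected before, the one
      rejected now is the newcomer \<open>r\<close>, and \<open>h\<close> keeps its
      residents.\<close>
    have same: "?A - {q} = ?M" if "\<forall>y\<in>?M. (y, h) \<in> rejected s"
      using that q rM by blast
    have "dp_effect I s r h {q} {}"
      unfolding dp_effect_def Let_def c
    proof (intro conjI impI allI)
      show "\<forall>x\<in>?A - {q}. (x, h) \<in> rejected s" if "lower I h < card ?M"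
        using same over[OF that] by blast
      fix x assume "(x, h) \<in> deleted s \<or> x \<in> {}"
      then have x: "(x, h) \<in> deleted s" by simp
      show "card ?M = upper I h" using del(1)[OF x] .
      show "\<forall>y\<in>?A - {q}. (y, h) \<in> rejected s \<and> beats I h y x"
        using same del(2)[OF x] by blast
    qed (use 2(1) q Mu in auto)
    moreover have "propose I r h s = s\<lparr>asg := insert (r, h) (asg s) - {q} \<times> {h},
       proposed := insert (r, h) (proposed s),
       rejected := rejected s \<union> {q} \<times> {h}, deleted := deleted s \<union> {} \<times> {h}\<rparr>"
      unfolding propose_def Let_def q_def using 2 by auto
    ultimately show ?thesis by blast
  next
    case 3
    have "(x, h) \<notin> deleted s" for x using del(1)[of x] 3 by auto
    moreover have "\<forall>x\<in>?A. (x, h) \<in> rejected s" using 3(2) by blast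
    ultimately have "dp_effect I s r h {} {}"
      using 3(1,3) cA by (simp add: dp_effect_def Let_def)
    moreover have "propose I r h s = s\<lparr>asg := insert (r, h) (asg s) - {} \<times> {h},
       proposed := insert (r, h) (proposed s),
       rejected := rejected s \<union> {} \<times> {h}, deleted := deleted s \<union> {} \<times> {h}\<rparr>"
      unfolding propose_def Let_def using 3 by auto
    ultimately show ?thesis by blast
  next
    case 4
    define q where "q = worst_resident I h ?A"
    have A: "finite ?A" "?A \<noteq> {}" "?A \<subseteq> residents I"
      using fM r(1) asg_subset by (auto simp: ress_of_def)
    note W = worst_resident_props[OF hrt_mslqD(3)[OF I h(1)] A, folded q_def]
    have c: "card (?A - {q}) = card ?M" using W(1) cA fM by (subst card_Diff_singleton) auto
    have rej: "(x, h) \<in> rejected s" if "x \<in> ?A" for x using 4(2) that by blast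
    have "beats I h y x" if y: "y \<in> ?A" "y \<noteq> q" and x: "(x, h) \<in> deleted s" for x y
    proof (cases "y \<in> ?M")
      case True
      then show ?thesis using del(2)[OF x] by blast
    next
      case False
      \<comment> \<open>Here \<open>y\<close> is the newcomer \<open>r\<close>, so the worst
        resident \<open>q\<close> is an old one, through which \<open>beats\<close> is
        chained.\<close>
      with y have "q \<in> ?M" using W(1) by blast
      then have "beats I h q x" using del(2)[OF x] by blast
      then show ?thesis
        using W(2)[OF y] beats_trans total_preorder_onD(2)[OF hrt_mslqD(3)[OF I h(1)]] by blast
    qed
    then have beats: "beats I h y x" if "y \<in> ?A" "y \<noteq> q" "(x, h) \<in> deleted s \<or> x = q" for x y
      using W(2) that by blast
    \<comment> \<open>The deletion is new, as termination requires: \<open>h\<close> is not deleted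
      for \<open>r\<close>, and any other deleted \<open>q\<close> in \<open>h\<close> would beat
      itself.\<close>
    have "(q, h) \<notin> deleted s"
    proof
      assume d: "(q, h) \<in> deleted s"
      then have "q \<in> ?M" using W(1) h(2) by auto
      then have "beats I h q q" using del(2)[OF d] by blast
      then show False by (simp add: beats_def)
    qed
    then have "dp_effect I s r h {q} {q}"
      unfolding dp_effect_def Let_def c using 4(1,3) W(1) Mu rej beats by auto
    moreover have "propose I r h s = s\<lparr>asg := insert (r, h) (asg s) - {q} \<times> {h},
       proposed := insert (r, h) (proposed s),
       rejected := rejected s \<union> {q} \<times> {h}, deleted := deleted s \<union> {q} \<times> {h}\<rparr>"
      unfolding propose_def Let_def q_def using 4 by auto
    ultimately show ?thesis by blast
  qed
qed

text \<open>The termination measure. No summand falls, since a hospital only ever replaces residents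
  or adds one, and each proposal brings an additional pair, a first rejection or a deletion.\<close>

definition dp_progress :: "dp_state \<Rightarrow> nat" where
  "dp_progress s = card (asg s) + card (rejected s) + card (deleted s)"

lemma propose_step:
  assumes I: "hrt_mslq I" and inv: "dp_invariant I s" and r: "r \<in> unmatched I s"
  shows "dp_invariant I (propose I r (target I s r) s)"
    and "dp_progress s < dp_progress (propose I r (target I s r) s)"
proof -
  interpret dp_invariant I s by (rule inv)
  define h where "h = target I s r"
  note T = target_props[OF I inv r, folded h_def]
  have rR: "r \<in> residents I" and un: "\<And>h. (r, h) \<notin> asg s"
    using r by (auto simp: unmatched_def hosps_of_def)
  obtain Q X where
    eq: "propose I r h s = s\<lparr>asg := insert (r, h) (asg s) - Q \<times> {h}, proposed := insert (r, h) (proposed s),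
       rejected := rejected s \<union> Q \<times> {h}, deleted := deleted s \<union> X \<times> {h}\<rparr>"
    and eff: "dp_effect I s r h Q X"
    using propose_effect[OF I inv rR un T(1,2)] by blast
  define B where "B = insert r (ress_of (asg s) h) - Q"
  have XQ: "X \<subseteq> Q" and Q: "Q \<subseteq> insert r (ress_of (asg s) h)"
    and up: "card (ress_of (asg s) h) \<le> card B" and le: "card B \<le> upper I h"
    and Qne: "Q \<noteq> {} \<longrightarrow> lower I h \<le> card (ress_of (asg s) h)"
    and ov: "lower I h < card B \<longrightarrow> (\<forall>x\<in>B. (x, h) \<in> rejected s)"
    and full: "\<forall>x. (x, h) \<in> deleted s \<or> x \<in> X \<longrightarrow>
          card B = upper I h \<and> (\<forall>y\<in>B. (y, h) \<in> rejected s \<and> beats I h y x)"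
    and prog: "card (ress_of (asg s) h) < card B \<or> \<not> Q \<times> {h} \<subseteq> rejected s \<or> \<not> X \<times> {h} \<subseteq> deleted s"
    using eff unfolding dp_effect_def Let_def B_def by - (elim conjE; assumption)+
  have over: "(x, h) \<in> rejected s" if "lower I h < card B" "x \<in> B" for x
    using ov that by blast
  have del: "card B = upper I h" "\<And>y. y \<in> B \<Longrightarrow> (y, h) \<in> rejected s" "\<And>y. y \<in> B \<Longrightarrow> beats I h y x"
    if "(x, h) \<in> deleted s \<or> x \<in> X" for x
    using full that by blast+
  define M' where "M' = insert (r, h) (asg s) - Q \<times> {h}"
  define J where "J = rejected s \<union> Q \<times> {h}"
  define K where "K = deleted s \<union> X \<times> {h}"
  have ress: "ress_of M' h' = (if h' = h then B else ress_of (asg s) h')" for h'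
    unfolding M'_def B_def by (rule ress_of_insert_diff)
  have eq': "propose I r h s = s\<lparr>asg := M', proposed := insert (r, h) (proposed s), rejected := J, deleted := K\<rparr>"
    using eq by (simp add: M'_def J_def K_def)
  define s' where "s' = propose I r h s"
  have s': "asg s' = M'" "proposed s' = insert (r, h) (proposed s)" "rejected s' = J" "deleted s' = K"
    by (simp_all add: s'_def eq')
  have mono: "card (ress_of (asg s) h') \<le> card (ress_of M' h')" for h'
    using up by (simp add: ress)
  have QM: "(x, h) \<in> asg s \<or> x = r" if "x \<in> Q" for x using Q that by (auto simp: ress_of_def)
  have asgM': "(x, h') \<in> M' \<longleftrightarrow> (if h' = h then x \<in> B else (x, h') \<in> asg s)" for x h'
    by (auto simp: M'_def B_def ress_of_def)
  have M'_sub: "M' \<subseteq> residents I \<times> hospitals I" using asg_subset rR T(1) by (auto simp: M'_def)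
  have M'_new: "(x, h') \<in> asg s \<or> x = r \<and> h' = h" if "(x, h') \<in> M'" for x h'
    using that by (auto simp: M'_def)
  have M'_Q: "(x, h) \<notin> M'" if "x \<in> Q" for x using that by (auto simp: M'_def)
  have prop_sub: "insert (r, h) (proposed s) \<subseteq> residents I \<times> hospitals I" using proposed_subset rR T(1) by auto
  have J_sub: "J \<subseteq> insert (r, h) (proposed s)" using rejected_proposed asg_proposed QM by (auto simp: J_def)
  have K_sub: "K \<subseteq> J" using deleted_rejected XQ by (auto simp: J_def K_def)
  show "dp_invariant I (propose I r (target I s r) s)"
    unfolding h_def[symmetric] s'_def[symmetric] dp_invariant_def s'
  proof (intro conjI allI impI)
    show "M' \<subseteq> residents I \<times> hospitals I" by fact
    show "h1 = h2" if "(x, h1) \<in> M'" "(x, h2) \<in> M'" for x h1 h2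
      using M'_new[OF that(1)] M'_new[OF that(2)] asg_unique un by blast
    show "card (ress_of M' h') \<le> upper I h'" if "h' \<in> hospitals I" for h'
      using upper_quota[OF that] le by (simp add: ress)
    show "insert (r, h) (proposed s) \<subseteq> residents I \<times> hospitals I" by fact
    show "K \<subseteq> J" "J \<subseteq> insert (r, h) (proposed s)" by fact+
    show "M' \<subseteq> insert (r, h) (proposed s)" using asg_proposed by (auto simp: M'_def)
    show "insert (r, h) (proposed s) \<subseteq> M' \<union> J" using proposed_cases by (auto simp: M'_def J_def)
    show "lower I h' \<le> card (ress_of M' h')" if "(x, h') \<in> J" for x h'
    proof -
      have "lower I h' \<le> card (ress_of (asg s) h')"
        using that rejected_lower[of x h'] Qne by (auto simp: J_def)
      then show ?thesis using mono[of h'] by simp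
    qed
    show "(x, h') \<in> J" if "lower I h' < card (ress_of M' h')" "(x, h') \<in> M'" for x h'
      using that over surplus_rejected[of h' x] by (cases "h' = h") (auto simp: J_def ress asgM')
    show "card (ress_of M' h') = upper I h'" if "(x, h') \<in> K" for x h'
      using that del(1)[of x] deleted_full[of x h'] by (cases "h' = h") (auto simp: K_def ress)
    show "(y, h') \<in> J" if "(x, h') \<in> K" "(y, h') \<in> M'" for x y h'
      using that del(2)[of x y] deleted_all_rejected[of x h' y] by (cases "h' = h") (auto simp: K_def J_def asgM')
    show "beats I h' y x" if "(x, h') \<in> K" "(y, h') \<in> M'" for x y h'
      using that del(3)[of x y] deleted_beaten[of x h' y] by (cases "h' = h") (auto simp: K_def asgM')
    show "(h1, h2) \<in> rpref I x" if "(x, h1) \<in> M'" "h2 \<in> hospitals I" "(x, h2) \<notin> K" for x h1 h2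
      using M'_new[OF that(1)] that asg_top[of x h1 h2] T(3)[of h2] by (auto simp: K_def)
    show "(x, h2) \<in> J" if "(x, h1) \<in> insert (r, h) (proposed s)" "tied I x h1 h2" "lower I h2 < lower I h1" for x h1 h2
      using that smaller_quota_first[of x h1 h2] T(4)[of h2] by (auto simp: J_def)
    show "(x, h2) \<in> J" if "(x, h1) \<in> M'" "(x, h1) \<in> J" "tied I x h1 h2" for x h1 h2
    proof -
      \<comment> \<open>Whoever is rejected in this proposal is not in \<open>h\<close> afterwards,
        so the rejection is an earlier one.\<close>
      have *: "(x, h1) \<in> rejected s" using that(1,2) M'_Q by (auto simp: J_def)
      then show ?thesis
        using M'_new[OF that(1)] that(3) second_proposal[of x h1 h2] T(5)[of h2] rejected_proposed by (auto simp: J_def)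
    qed
  qed
  have fin: "finite M'" "finite J" "finite K"
    using M'_sub prop_sub J_sub K_sub by (meson finite_SigmaI finite_hospitals finite_residents finite_subset)+
  have a: "card (asg s) \<le> card M'"
    unfolding sum_card_ress_of[OF asg_subset, symmetric] sum_card_ress_of[OF M'_sub, symmetric]
    by (intro sum_mono mono)
  have j: "card (rejected s) \<le> card J" and k: "card (deleted s) \<le> card K"
    using fin by (auto intro!: card_mono simp: J_def K_def)
  have "card (asg s) < card M' \<or> card (rejected s) < card J \<or> card (deleted s) < card K"
    using prog
  proof (elim disjE)
    assume "card (ress_of (asg s) h) < card (B)"
    then have "(\<Sum>h\<in>hospitals I. card (ress_of (asg s) h)) < (\<Sum>h\<in>hospitals I. card (ress_of M' h))"
      using T(1) mono by (intro sum_strict_mono_ex1 ballI bexI[of _ h]) (auto simp: ress)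
    then show ?thesis by (simp add: sum_card_ress_of asg_subset M'_sub)
  next
    assume "\<not> Q \<times> {h} \<subseteq> rejected s"
    then show ?thesis using fin psubset_card_mono[of J "rejected s"] by (auto simp: J_def)
  next
    assume "\<not> X \<times> {h} \<subseteq> deleted s"
    then show ?thesis using fin psubset_card_mono[of K "deleted s"] by (auto simp: K_def)
  qed
  then show "dp_progress s < dp_progress (propose I r (target I s r) s)"
    unfolding h_def[symmetric] s'_def[symmetric] dp_progress_def s' using a j k by linarith
qed

section \<open>Termination and properties of the output\<close>

lemma dp_progress_bound:
  assumes "dp_invariant I s"
  shows "dp_progress s \<le> 3 * card (residents I \<times> hospitals I)"
proof -
  interpret dp_invariant I s by (rule assms)
  have fin: "finite (residents I \<times> hospitals I)" by simp
  have "card (asg s) \<le> card (residents I \<times> hospitals I)"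
    "card (rejected s) \<le> card (residents I \<times> hospitals I)"
    "card (deleted s) \<le> card (residents I \<times> hospitals I)"
    using asg_subset proposed_subset deleted_rejected rejected_proposed by (intro card_mono[OF fin]; blast)+
  then show ?thesis by (simp add: dp_progress_def)
qed

lemma double_proposal_final:
  assumes I: "hrt_mslq I"
  obtains s where "double_proposal I = asg s" "dp_invariant I s" "unmatched I s = {}"
proof -
  let ?b = "\<lambda>s. unmatched I s \<noteq> {}"
  let ?N = "3 * card (residents I \<times> hospitals I)"
  let ?s = "while ?b (dp_step I) dp_init"
  have step: "dp_invariant I (dp_step I s) \<and> dp_progress s < dp_progress (dp_step I s)"
    if s: "dp_invariant I s" "?b s" for s
  proof -
    have "Min (unmatched I s) \<in> unmatched I s"
      using s(2) by (intro Min_in) (auto simp: unmatched_def)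
    from propose_step[OF I s(1) this] show ?thesis by (simp add: dp_step_def Let_def)
  qed
  have "dp_invariant I ?s \<and> unmatched I ?s = {}"
  proof (rule while_rule[where P = "dp_invariant I" and r = "measure (\<lambda>s. ?N - dp_progress s)"])
    show "dp_invariant I dp_init" by (rule dp_invariant_init[OF I])
    show "(dp_step I s, s) \<in> measure (\<lambda>s. ?N - dp_progress s)" if "dp_invariant I s" "?b s" for s
      using step[OF that] dp_progress_bound[of I "dp_step I s"]
      by (simp del: card_cartesian_product) linarith
  qed (use step in auto)
  then show thesis using that[of ?s] by (simp add: double_proposal_def)
qed

text \<open>A strictly preferred hospital has been deleted for \<open>r\<close>, hence is full of
  residents that beat \<open>r\<close>. The tied hospital of the last fact has rejected
  \<open>r\<close>, hence has reached its lower quota.\<close>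

lemma double_proposal_props:
  assumes I: "hrt_mslq I"
  defines "M \<equiv> double_proposal I"
  shows "matching I M" "\<And>r. r \<in> residents I \<Longrightarrow> \<exists>h. hosps_of M r = {h}"
    "\<And>r h h'. (r, h) \<in> M \<Longrightarrow> h' \<in> hospitals I \<Longrightarrow> strictly (rpref I r) h' h \<Longrightarrow>
      card (ress_of M h') = upper I h' \<and> (\<forall>r'\<in>ress_of M h'. beats I h' r' r)"
    "\<And>r h h'. (r, h) \<in> M \<Longrightarrow> tied I r h h' \<Longrightarrow>
      lower I h' < lower I h \<or> lower I h < card (ress_of M h) \<Longrightarrow> lower I h' \<le> card (ress_of M h')"
proof -
  obtain s where s: "M = asg s" "dp_invariant I s" "unmatched I s = {}"
    using double_proposal_final[OF I] M_def by blast
  interpret dp_invariant I s by (rule s(2))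
  show single: "\<exists>h. hosps_of M r = {h}" if "r \<in> residents I" for r
  proof -
    have "hosps_of M r \<noteq> {}" using s(1,3) that by (auto simp: unmatched_def)
    then obtain h where "h \<in> hosps_of M r" by blast
    then have "hosps_of M r = {h}" using asg_unique by (auto simp: hosps_of_def s(1))
    then show ?thesis ..
  qed
  show "matching I M" unfolding matching_def
  proof (intro conjI ballI)
    show "card (hosps_of M r) \<le> 1" if "r \<in> residents I" for r using single[OF that] by auto
  qed (use asg_subset upper_quota s(1) in auto)
  show "card (ress_of M h') = upper I h' \<and> (\<forall>r'\<in>ress_of M h'. beats I h' r' r)"
    if "(r, h) \<in> M" "h' \<in> hospitals I" "strictly (rpref I r) h' h" for r h h'
  proof -
    have "(r, h') \<in> deleted s" using asg_top[OF that(1)[unfolded s(1)] that(2)] that(3) by (auto simp: strictly_def)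
    then show ?thesis using deleted_full deleted_beaten by (auto simp: ress_of_def s(1))
  qed
  show "lower I h' \<le> card (ress_of M h')"
    if "(r, h) \<in> M" "tied I r h h'" "lower I h' < lower I h \<or> lower I h < card (ress_of M h)" for r h h'
  proof -
    \<comment> \<open>If \<open>h'\<close> has the smaller quota, \<open>r\<close> tried it first.
      If \<open>h\<close> exceeds its lower quota, it has already rejected \<open>r\<close>, so
      \<open>second_proposal\<close> applies.\<close>
    have "(r, h') \<in> rejected s"
      using that asg_proposed surplus_rejected smaller_quota_first second_proposal unfolding s(1) by blast
    then show ?thesis unfolding s(1) by (rule rejected_lower)
  qed
qed

section \<open>The upper bound\<close>

lemma phi_altdef: "n \<noteq> 2 \<Longrightarrow> phi n = real n * (1 + real (n div 2)) / (real n + real (n div 2))"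
  by (simp add: phi_def)

text \<open>The factor \<open>n * (1 + x) / (n + x)\<close> does not decrease with \<open>x\<close>,
  so \<open>x = n div 2\<close> is extreme. For \<open>n = 2\<close> this gives 4/3, below
  \<open>phi 2\<close>.\<close>

lemma le_phi_of_weighted:
  assumes n: "1 \<le> n" and x: "2 * x \<le> n" and s: "0 \<le> s"
    and t: "t * (1 + real x / real n) \<le> (1 + real x) * s"
  shows "t \<le> phi n * s"
proof -
  have "t * (real n + real x) = real n * (t * (1 + real x / real n))"
    using n by (simp add: field_simps)
  also have "\<dots> \<le> real n * ((1 + real x) * s)" using t by (intro mult_left_mono) auto
  finally have 1: "t \<le> real n * (1 + real x) / (real n + real x) * s"
    using n by (simp add: field_simps)
  have "real n * (1 + real x) / (real n + real x) \<le> phi n"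
  proof (cases "n = 2")
    case True
    then have "x = 0 \<or> x = 1" using x by auto
    then show ?thesis using True by (auto simp: phi_def)
  next
    case False
    define k where "k = n div 2"
    have "0 \<le> (real k - real x) * (real n - 1)" using n x by (simp add: k_def)
    then have "(1 + real x) * (real n + real k) \<le> (1 + real k) * (real n + real x)"
      by (simp add: algebra_simps)
    then have "(1 + real x) / (real n + real x) \<le> (1 + real k) / (real n + real k)"
      using n by (intro frac_le_eq[THEN iffD2] | simp add: divide_simps mult.commute)+
    then have "real n * ((1 + real x) / (real n + real x)) \<le> real n * ((1 + real k) / (real n + real k))"
      by (intro mult_left_mono) auto
    then show ?thesis using False by (simp add: phi_altdef k_def)
  qed
  then show ?thesis using 1 s by (meson mult_right_mono order_trans)
qed

text \<open>With \<open>k = n div 2\<close> the general formula requires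
  \<open>k * (k + 2) \<le> k * n\<close>, which holds for \<open>n \<ge> 3\<close> but fails for
  \<open>n = 2\<close>; there this bound is what yields the value 3/2.\<close>

lemma one_plus_half_le_phi:
  assumes n: "1 \<le> n" and x: "2 * x \<le> n"
  shows "1 + real x / 2 \<le> phi n"
proof (cases "n \<le> 2")
  case True
  then have "n = 1 \<and> x = 0 \<or> n = 2 \<and> x \<le> 1" using n x by auto
  then show ?thesis by (auto simp: phi_def)
next
  case False
  define k where "k = n div 2"
  have "k + 2 \<le> n" using False by (simp add: k_def)
  then have kn: "real k + 2 \<le> real n" by linarith
  have xk: "real x \<le> real k" using x by (simp add: k_def)
  have "real k * (real k + 2) \<le> real k * real n" using kn by (intro mult_left_mono) auto
  then have "(1 + real k / 2) * (real n + real k) \<le> real n * (1 + real k)"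
    by (simp add: field_simps)
  then have "1 + real k / 2 \<le> real n * (1 + real k) / (real n + real k)"
    using False by (simp add: pos_le_divide_eq)
  then show ?thesis using xk False by (simp add: phi_altdef k_def)
qed

section \<open>Matchings as functions on the residents\<close>

lemma score_eq_sum_quota_score:
  "score I M = (\<Sum>h\<in>hospitals I. quota_score (lower I h) (card (ress_of M h)))"
  by (simp add: score_def hosp_score_def quota_score_def)

lemma ress_of_function:
  assumes "M \<subseteq> residents I \<times> hospitals I" "\<And>r. r \<in> residents I \<Longrightarrow> hosps_of M r = {f r}"
  shows "ress_of M h = {r \<in> residents I. f r = h}"
proof -
  have "(r, h) \<in> M \<longleftrightarrow> h = f r" if "r \<in> residents I" for r
    using assms(2)[OF that] by (auto simp: hosps_of_def)
  then show ?thesis using assms(1) by (auto simp: ress_of_def)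
qed

text \<open>An unmatched resident would block with a hospital that is not full.\<close>

lemma stable_matching_total:
  assumes I: "hrt_mslq I" and N: "stable_matching I N" and r: "r \<in> residents I"
  shows "\<exists>h. hosps_of N r = {h}"
proof -
  have sub: "N \<subseteq> residents I \<times> hospitals I"
    and one: "\<And>r. r \<in> residents I \<Longrightarrow> card (hosps_of N r) \<le> 1"
    using N by (auto simp: stable_matching_def matching_def)
  have fin: "finite (hosps_of N r)" for r
    by (rule finite_subset[of _ "hospitals I"]) (use sub in \<open>auto simp: hosps_of_def\<close>)
  have uni: "h = h'" if "(r, h) \<in> N" "(r, h') \<in> N" for r h h'
  proof -
    have "r \<in> residents I" using that sub by auto
    then show ?thesis using one[of r] fin[of r] that card_le_Suc0_iff_eq[of "hosps_of N r"]
      by (auto simp: hosps_of_def)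
  qed
  obtain h where "h \<in> hospitals I" "card (ress_of N h) < upper I h"
    using some_hospital_not_full[OF I sub] uni by blast
  then have "hosps_of N r \<noteq> {}"
    using N r by (auto simp: stable_matching_def blocks_def)
  then obtain h where "h \<in> hosps_of N r" by blast
  then have "hosps_of N r = {h}" using uni by (auto simp: hosps_of_def)
  then show ?thesis ..
qed

lemma score_le_phi_ALG:
  assumes I: "hrt_mslq I" and N: "stable_matching I N"
  shows "score I N \<le> phi (num_residents I) * ALG I"
proof -
  let ?M = "double_proposal I"
  note P = double_proposal_props[OF I]
  obtain a where a: "\<And>r. r \<in> residents I \<Longrightarrow> hosps_of ?M r = {a r}" using P(2) by metis
  obtain b where b: "\<And>r. r \<in> residents I \<Longrightarrow> hosps_of N r = {b r}"
    using stable_matching_total[OF I N] by metis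
  have subM: "?M \<subseteq> residents I \<times> hospitals I" using P(1) by (simp add: matching_def)
  have subN: "N \<subseteq> residents I \<times> hospitals I" using N by (simp add: stable_matching_def matching_def)
  have resM: "ress_of ?M h = {r \<in> residents I. a r = h}" for h
    using ress_of_function[OF subM, of a] a by blast
  have resN: "ress_of N h = {r \<in> residents I. b r = h}" for h
    using ress_of_function[OF subN, of b] b by blast
  have aM: "(r, a r) \<in> ?M" "a r \<in> hospitals I" if "r \<in> residents I" for r
    using a[OF that] subM by (auto simp: hosps_of_def)
  have bN: "(r, b r) \<in> N" "b r \<in> hospitals I" if "r \<in> residents I" for r
    using b[OF that] subN by (auto simp: hosps_of_def)
  let ?ca = "\<lambda>h. card {r \<in> residents I. a r = h}" and ?cb = "\<lambda>h. card {r \<in> residents I. b r = h}"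
  have cR: "card (residents I) = num_residents I" by (simp add: residents_def)
  interpret reassignment "residents I" "hospitals I" a b "lower I" ?ca ?cb
  proof (unfold_locales, goal_cases)
    case 3
    then show ?case using hrt_mslqD(1)[OF I] by (simp add: residents_def)
  next
    case (6 h)
    then show ?case using hrt_mslqD(4,5)[OF I, of h] by (simp add: cR)
  next
    case (7 r)
    let ?g = "a r" and ?h = "b r"
    note H = aM[OF 7(1)] bN[OF 7(1)]
    note p = hrt_mslqD(2)[OF I 7(1)]
    \<comment> \<open>A gaining hospital is below its lower quota, hence not full in the output, so
      \<open>r\<close> cannot strictly prefer it.\<close>
    have "?ca ?h < upper I ?h" using 7(3) hrt_mslqD(4)[OF I H(4)] by linarith
    then have "\<not> strictly (rpref I r) ?h ?g"
      using P(3)[OF H(1) H(4)] resM[of ?h] by auto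
    then have gh: "(?g, ?h) \<in> rpref I r"
      using total_preorder_onD(3)[OF p H(2) H(4)] by (auto simp: strictly_def)
    show ?case
    proof (cases "(?h, ?g) \<in> rpref I r")
      case True
      \<comment> \<open>As \<open>?h\<close> is below its lower quota, the contrapositive of the tie
        property excludes both a smaller quota at \<open>?h\<close> and a surplus at
        \<open>?g\<close>.\<close>
      then have "tied I r ?g ?h" using gh by (simp add: tied_def)
      from P(4)[OF H(1) this] show ?thesis using 7(3) by (fastforce simp: resM)
    next
      case False
      then have "strictly (rpref I r) ?g ?h" using gh by (simp add: strictly_def)
      \<comment> \<open>Since \<open>r\<close> strictly prefers \<open>?g\<close> to its hospital in
        \<open>N\<close>, stability makes \<open>?g\<close> full in \<open>N\<close>.\<close>
      moreover have "\<not> blocks I N r ?g"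
        using N 7(1) H(2) by (auto simp: stable_matching_def)
      ultimately have "upper I ?g \<le> ?cb ?g"
        using b[OF 7(1)] by (auto simp: blocks_def resN)
      moreover have "?ca ?g \<le> upper I ?g" using P(1) H(2) by (auto simp: matching_def resM)
      ultimately show ?thesis using hrt_mslqD(4)[OF I H(2)] by linarith
    qed
  qed (use aM bN in auto)
  let ?n = "num_residents I"
  have sM: "ALG I = (\<Sum>h\<in>hospitals I. quota_score (lower I h) (?ca h))"
    by (simp add: ALG_def score_eq_sum_quota_score resM)
  have sN: "score I N = (\<Sum>h\<in>hospitals I. quota_score (lower I h) (?cb h))"
    by (simp add: score_eq_sum_quota_score resN)
  have A0: "0 \<le> ALG I" unfolding sM by (intro sum_nonneg quota_score_nonneg)
  have n: "1 \<le> ?n" by (rule hrt_mslqD(1)[OF I])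
  obtain x where x: "2 * x \<le> ?n"
    "score I N * (1 + real x / real ?n) \<le> (1 + real x) * ALG I \<or> score I N \<le> (1 + real x / 2) * ALG I"
    using total_ratio unfolding sM[symmetric] sN[symmetric] cR by blast
  from x(2) show ?thesis
  proof
    assume "score I N * (1 + real x / real ?n) \<le> (1 + real x) * ALG I"
    then show ?thesis by (rule le_phi_of_weighted[OF n x(1) A0])
  next
    assume "score I N \<le> (1 + real x / 2) * ALG I"
    also have "\<dots> \<le> phi ?n * ALG I"
      using one_plus_half_le_phi[OF n x(1)] A0 by (intro mult_right_mono)
    finally show ?thesis .
  qed
qed

lemma double_proposal_stable:
  assumes I: "hrt_mslq I"
  shows "stable_matching I (double_proposal I)"
proof -
  let ?M = "double_proposal I"
  note P = double_proposal_props[OF I]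
  have "\<not> blocks I ?M r h" if r: "r \<in> residents I" and h: "h \<in> hospitals I" for r h
  proof
    assume bl: "blocks I ?M r h"
    obtain g where g: "hosps_of ?M r = {g}" using P(2)[OF r] by blast
    then have "(r, g) \<in> ?M" by (auto simp: hosps_of_def)
    moreover have "strictly (rpref I r) h g" using bl g by (auto simp: blocks_def)
    ultimately have "card (ress_of ?M h) = upper I h" "\<forall>r'\<in>ress_of ?M h. beats I h r' r"
      using P(3) h by blast+
    then show False using bl by (auto simp: blocks_def strictly_def beats_def)
  qed
  then show ?thesis using P(1) by (auto simp: stable_matching_def)
qed

section \<open>Attainment of the optimum\<close>

lemma finite_stable_scores: "finite {score I M | M. stable_matching I M}"
proof -
  have "{score I M | M. stable_matching I M} \<subseteq> score I ` Pow (residents I \<times> hospitals I)"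
    by (auto simp: stable_matching_def matching_def)
  then show ?thesis by (rule finite_subset) simp
qed

lemma score_le_OPT: "stable_matching I M \<Longrightarrow> score I M \<le> OPT I"
  unfolding OPT_def using finite_stable_scores by (intro Max_ge) auto

lemma OPT_le_phi_ALG:
  assumes "hrt_mslq I"
  shows "OPT I \<le> phi (num_residents I) * ALG I"
proof -
  have "{score I M | M. stable_matching I M} \<noteq> {}" using double_proposal_stable[OF assms] by auto
  then have "OPT I \<in> {score I M | M. stable_matching I M}"
    unfolding OPT_def by (rule Max_in[OF finite_stable_scores])
  then show ?thesis using score_le_phi_ALG[OF assms] by auto
qed

lemma phi_nonneg: "0 \<le> phi n"
  by (simp add: phi_def)

lemma OPT_ALG_ratio_le:
  assumes "hrt_mslq I"
  shows "OPT I / ALG I \<le> phi (num_residents I)"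
proof (cases "ALG I = 0")
  case False
  then have "0 < ALG I"
    unfolding ALG_def score_eq_sum_quota_score
    by (metis (no_types, lifting) sum_nonneg quota_score_nonneg order_less_le)
  then show ?thesis using OPT_le_phi_ALG[OF assms] by (simp add: pos_divide_le_eq)
\<comment> \<open>Division by zero yields 0.\<close>
qed (simp add: phi_nonneg)

section \<open>A tight instance\<close>

text \<open>Smaller ranks are better. Beyond hospital 1, residents of small index are indifferent
  and can be moved freely; the others go by index and so want hospital 2 next.\<close>

definition tight_rank :: "nat \<Rightarrow> nat \<Rightarrow> nat \<Rightarrow> nat" where
  "tight_rank n r h = (if h = 1 then 0 else if r \<le> n - n div 2 then 1 else h)"

text \<open>
  Hospital 1 is the common favourite, hospital 2 the one where the algorithm wastes the
  residents rejected by hospital 1, and the others are left empty by the algorithm. For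
  \<open>n = 2\<close> the ratio is larger if hospital 2 has lower quota 0.
\<close>
definition tight_instance :: "nat \<Rightarrow> hrt_instance" where
  "tight_instance n = \<lparr>num_residents = n, num_hospitals = n div 2 + 2,
     rpref = \<lambda>r. {(x, y). x \<in> {1..n div 2 + 2} \<and> y \<in> {1..n div 2 + 2} \<and> tight_rank n r x \<le> tight_rank n r y},
     hpref = \<lambda>h. {1..n} \<times> {1..n},
     lower = \<lambda>h. if h = 1 then 0 else if h = 2 then (if n = 2 then 0 else n) else 1,
     upper = \<lambda>h. if h = 1 then n - n div 2 else if h = 2 then n else 1\<rparr>"

lemma tight_simps:
  "num_residents (tight_instance n) = n"
  "residents (tight_instance n) = {1..n}"
  "hospitals (tight_instance n) = {1..n div 2 + 2}"
  "hpref (tight_instance n) h = {1..n} \<times> {1..n}"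
  "lower (tight_instance n) h = (if h = 1 then 0 else if h = 2 then (if n = 2 then 0 else n) else 1)"
  "upper (tight_instance n) h = (if h = 1 then n - n div 2 else if h = 2 then n else 1)"
  by (simp_all add: tight_instance_def residents_def hospitals_def)

lemma tight_strictly:
  "strictly (rpref (tight_instance n) r) x y \<longleftrightarrow>
    x \<in> {1..n div 2 + 2} \<and> y \<in> {1..n div 2 + 2} \<and> tight_rank n r x < tight_rank n r y"
  by (auto simp: strictly_def tight_instance_def)

lemma sum_tight_hospitals:
  "(\<Sum>h\<in>{1..k + 2}. f h) = f 1 + f 2 + (\<Sum>h\<in>{3..k + 2}. f h)" for f :: "nat \<Rightarrow> 'a::comm_monoid_add"
proof -
  have "{1..k + 2} = insert 1 (insert 2 {3..k + 2})" by auto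
  then show ?thesis by (simp add: add.assoc)
qed

lemma hrt_mslq_tight_instance:
  assumes "1 \<le> n"
  shows "hrt_mslq (tight_instance n)"
proof -
  have "total_preorder_on {1..n div 2 + 2} (rpref (tight_instance n) r)" for r
    by (auto simp: tight_instance_def total_preorder_on_def preorder_on_def refl_on_def trans_def total_on_def)
  moreover have "total_preorder_on {1..n} ({1..n} \<times> {1..n})"
    by (auto simp: total_preorder_on_def preorder_on_def refl_on_def trans_def total_on_def)
  moreover have "n < (\<Sum>h\<in>{1..n div 2 + 2}. upper (tight_instance n) h)"
  proof -
    have "(\<Sum>h\<in>{3..n div 2 + 2}. upper (tight_instance n) h) = (\<Sum>h\<in>{3..n div 2 + 2}. 1)"
      by (intro sum.cong) (auto simp: tight_simps)
    then show ?thesis unfolding sum_tight_hospitals using assms by (simp add: tight_simps)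
  qed
  moreover have "\<forall>h\<in>hospitals (tight_instance n). lower (tight_instance n) h \<le> upper (tight_instance n) h \<and>
      upper (tight_instance n) h \<le> n \<and> upper (tight_instance n) h \<ge> 1"
    using assms by (auto simp: tight_simps)
  ultimately show ?thesis using assms unfolding hrt_mslq_def tight_simps(1-4) by auto
qed

text \<open>As \<open>n div 2 \<le> n - n div 2\<close>, those placed outside hospital 1 are all
  indifferent beyond it; the others fill it exactly.\<close>

definition tight_assignment :: "nat \<Rightarrow> assignment" where
  "tight_assignment n = {(r, if r \<le> n div 2 then r + 2 else 1) | r. r \<in> {1..n}}"

lemma tight_assignment_simps:
  "r \<in> {1..n} \<Longrightarrow> hosps_of (tight_assignment n) r = {if r \<le> n div 2 then r + 2 else 1}"
  "ress_of (tight_assignment n) 1 = {n div 2 + 1..n}"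
  "ress_of (tight_assignment n) 2 = {}"
  "h \<in> {3..n div 2 + 2} \<Longrightarrow> ress_of (tight_assignment n) h = {h - 2}"
  by (auto simp: tight_assignment_def hosps_of_def ress_of_def split: if_splits)

lemma stable_tight_assignment:
  "stable_matching (tight_instance n) (tight_assignment n)"
proof -
  let ?I = "tight_instance n" and ?N = "tight_assignment n"
  have "matching ?I ?N"
    unfolding matching_def tight_simps(1-3)
  proof (intro conjI ballI)
    show "?N \<subseteq> {1..n} \<times> {1..n div 2 + 2}" by (auto simp: tight_assignment_def)
    show "card (hosps_of ?N r) \<le> 1" if "r \<in> {1..n}" for r
      using tight_assignment_simps(1)[OF that] by simp
    show "card (ress_of ?N h) \<le> upper ?I h" if "h \<in> {1..n div 2 + 2}" for h
    proof -
      have "h = 1 \<or> h = 2 \<or> h \<in> {3..n div 2 + 2}" using that by auto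
      then show ?thesis
        using tight_assignment_simps(2,3)[of n] tight_assignment_simps(4)[of h n]
        by (elim disjE) (auto simp: tight_simps)
    qed
  qed
  moreover have "\<not> blocks ?I ?N r h" if r: "r \<in> {1..n}" and h: "h \<in> {1..n div 2 + 2}" for r h
  proof
    assume bl: "blocks ?I ?N r h"
    have hp: "\<not> strictly (hpref ?I h) r r'" if "r' \<in> ress_of ?N h" for r'
      using that r by (auto simp: strictly_def tight_simps tight_assignment_def ress_of_def)
    let ?g = "if r \<le> n div 2 then r + 2 else 1"
    have "tight_rank n r h < tight_rank n r ?g"
      using bl tight_assignment_simps(1)[OF r] by (auto simp: blocks_def tight_strictly)
    \<comment> \<open>Only hospital 1 can be preferred to an assigned one, and it is full of
      residents it ranks equal to \<open>r\<close>.\<close>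
    then have "h = 1" by (auto simp: tight_rank_def split: if_splits)
    then have "card (ress_of ?N h) = upper ?I h"
      using tight_assignment_simps(2)[of n] by (simp add: tight_simps)
    then show False using bl hp by (auto simp: blocks_def)
  qed
  ultimately show ?thesis unfolding stable_matching_def tight_simps(2,3) by blast
qed

lemma score_tight_assignment:
  assumes "1 \<le> n"
  shows "score (tight_instance n) (tight_assignment n) = 1 + (if n = 2 then 1 else 0) + real (n div 2)"
proof -
  have "(\<Sum>h\<in>{3..n div 2 + 2}. hosp_score (tight_instance n) (tight_assignment n) h) = (\<Sum>h\<in>{3..n div 2 + 2}. 1)"
    using tight_assignment_simps(4) by (intro sum.cong) (auto simp: hosp_score_def tight_simps)
  then show ?thesis
    unfolding score_def tight_simps(3) sum_tight_hospitals
    using assms by (simp add: hosp_score_def tight_simps tight_assignment_simps(2,3)[simplified])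
qed

text \<open>The output is pinned down by \<open>double_proposal_props\<close> alone, where
  \<open>beats\<close> here compares indices.\<close>

lemma ALG_tight_instance:
  assumes n: "1 \<le> n"
  shows "ALG (tight_instance n) = 1 + (if n = 2 then 1 else real (n div 2) / real n)"
proof -
  let ?I = "tight_instance n" and ?k = "n div 2"
  let ?M = "double_proposal ?I"
  note P = double_proposal_props[OF hrt_mslq_tight_instance[OF n]]
  obtain a where a: "\<And>r. r \<in> residents ?I \<Longrightarrow> hosps_of ?M r = {a r}" using P(2) by metis
  have subM: "?M \<subseteq> residents ?I \<times> hospitals ?I" using P(1) by (simp add: matching_def)
  have res: "ress_of ?M h = {r \<in> {1..n}. a r = h}" for h
    using ress_of_function[OF subM, of a h] a unfolding tight_simps(2) by blast
  have aM: "(r, a r) \<in> ?M" "a r \<in> {1..?k + 2}" if "r \<in> {1..n}" for r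
    using a[of r] subM that by (auto simp: hosps_of_def tight_simps)
  have up: "card (ress_of ?M h) \<le> upper ?I h" if "h \<in> {1..?k + 2}" for h
    using P(1) that by (auto simp: matching_def tight_simps)
  have low: "a r = 1" if r: "r \<in> {1..n}" "r \<le> n - ?k" for r
  proof (rule ccontr)
    assume "a r \<noteq> 1"
    then have "strictly (rpref ?I r) 1 (a r)"
      using aM(2)[OF r(1)] r by (auto simp: tight_strictly tight_rank_def)
    then have full: "card (ress_of ?M 1) = upper ?I 1 \<and> (\<forall>r'\<in>ress_of ?M 1. beats ?I 1 r' r)"
      by (rule P(3)[OF aM(1)[OF r(1)], rotated]) (simp add: tight_simps)
    then have c: "card (ress_of ?M 1) = n - ?k" by (simp add: tight_simps)
    \<comment> \<open>Hospital 1 would hold \<open>n - ?k\<close> residents of smaller index than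
      \<open>r\<close>, but there are only \<open>r - 1 < n - ?k\<close> of them.\<close>
    have "ress_of ?M 1 \<subseteq> {1..<r}"
    proof
      fix r' assume r': "r' \<in> ress_of ?M 1"
      then have "r' \<in> {1..n}" by (simp add: res)
      moreover have "beats ?I 1 r' r" using full r' by blast
      ultimately show "r' \<in> {1..<r}" using r(1) by (simp add: beats_def tight_simps)
    qed
    then have "card (ress_of ?M 1) \<le> card {1..<r}" by (intro card_mono) auto
    then show False using c r by auto
  qed
  have "{1..n - ?k} \<subseteq> ress_of ?M 1" using low by (auto simp: res)
  moreover have "card (ress_of ?M 1) \<le> n - ?k" using up[of 1] by (simp add: tight_simps)
  ultimately have r1: "ress_of ?M 1 = {1..n - ?k}"
    using finite_ress_of[OF subM] by (intro card_seteq[symmetric]) auto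
  have high: "a r = 2" if r: "r \<in> {1..n}" "n - ?k < r" for r
  proof (rule ccontr)
    assume "a r \<noteq> 2"
    moreover have "a r \<noteq> 1"
    proof
      assume "a r = 1"
      then have "r \<in> ress_of ?M 1" using r(1) by (simp add: res del: One_nat_def)
      then show False using r(2) by (simp add: r1 del: One_nat_def)
    qed
    \<comment> \<open>Hospital 2 has room for all \<open>n\<close> residents, so it can only be full
      if it holds \<open>r\<close> as well.\<close>
    ultimately have "strictly (rpref ?I r) 2 (a r)"
      using aM(2)[OF r(1)] r by (auto simp: tight_strictly tight_rank_def)
    then have "card (ress_of ?M 2) = upper ?I 2 \<and> (\<forall>r'\<in>ress_of ?M 2. beats ?I 2 r' r)"
      by (rule P(3)[OF aM(1)[OF r(1)], rotated]) (simp add: tight_simps)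
    then have "card (ress_of ?M 2) = n" by (simp add: tight_simps)
    then have "ress_of ?M 2 = {1..n}"
      by (intro card_subset_eq) (auto simp: res)
    then have "r \<in> ress_of ?M 2" using r(1) by blast
    then show False using \<open>a r \<noteq> 2\<close> by (simp add: res)
  qed
  have ar: "a r = (if r \<le> n - ?k then 1 else 2)" if "r \<in> {1..n}" for r
    using low[OF that] high[OF that] by (cases "r \<le> n - ?k") auto
  have "ress_of ?M 2 = {r \<in> {1..n}. n - ?k < r}"
    unfolding res by (auto simp: ar split: if_splits)
  also have "\<dots> = {n - ?k + 1..n}" by auto
  finally have r2: "ress_of ?M 2 = {n - ?k + 1..n}" .
  have r3: "ress_of ?M h = {}" if "h \<in> {3..?k + 2}" for h
    unfolding res using that by (auto simp: ar split: if_splits)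
  have "(\<Sum>h\<in>{3..?k + 2}. hosp_score ?I ?M h) = (\<Sum>h\<in>{3..?k + 2}. 0)"
    using r3 by (intro sum.cong) (auto simp: hosp_score_def tight_simps)
  moreover have "card (ress_of ?M 2) = ?k" unfolding r2 by simp
  moreover have "hosp_score ?I ?M 1 = 1" by (simp add: hosp_score_def tight_simps)
  moreover have "hosp_score ?I ?M 2 = (if n = 2 then 1 else real ?k / real n)"
    using n \<open>card (ress_of ?M 2) = ?k\<close> by (auto simp: hosp_score_def tight_simps min_def)
  ultimately show ?thesis
    unfolding ALG_def score_def tight_simps(3) sum_tight_hospitals by simp
qed

theorem theorem7:
  fixes n :: nat
  assumes "n \<ge> 1"
  shows "is_maximum {OPT I / ALG I | I :: hrt_instance. hrt_mslq I \<and> num_residents I = n} (phi n)"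
proof -
  let ?I = "tight_instance n"
  note I = hrt_mslq_tight_instance[OF assms]
  have "phi n * ALG ?I = score ?I (tight_assignment n)"
  proof -
    \<comment> \<open>Settles \<open>n \<noteq> 2\<close> with \<open>k = n div 2\<close>; for
      \<open>n = 2\<close> the two scores are 3 and 2.\<close>
    have "real n * (1 + k) / (real n + k) * (1 + k / real n) = 1 + k" if "0 \<le> k" for k
    proof -
      have "real n + k \<noteq> 0" using assms that by linarith
      moreover have "1 + k / real n = (real n + k) / real n" using assms by (simp add: add_divide_distrib)
      ultimately show ?thesis using assms by simp
    qed
    from this[of "real (n div 2)"] show ?thesis
      using assms by (auto simp: ALG_tight_instance score_tight_assignment phi_altdef phi_def[of 2])
  qed
  also have "\<dots> \<le> OPT ?I" by (rule score_le_OPT[OF stable_tight_assignment])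
  finally have "OPT ?I = phi n * ALG ?I"
    using OPT_le_phi_ALG[OF I] by (simp add: tight_simps)
  moreover have "ALG ?I \<noteq> 0"
    using assms by (simp add: ALG_tight_instance add_nonneg_eq_0_iff)
  ultimately have "phi n = OPT ?I / ALG ?I" by simp
  then have "phi n \<in> {OPT I / ALG I | I :: hrt_instance. hrt_mslq I \<and> num_residents I = n}"
    using I tight_simps(1) by blast
  moreover have "OPT J / ALG J \<le> phi n" if "hrt_mslq J" "num_residents J = n" for J
    using OPT_ALG_ratio_le[OF that(1)] that(2) by simp
  ultimately show ?thesis unfolding is_maximum_def by blast
qed

end
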